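(* Let $a<b$, $\Omega:=(a,b)$, $1<p<\infty$, $p':=p/(p-1)$, and let $m\in L^{p'}(\Omega)$ (possibly sign-changing). Let $f:(0,\infty)\to(0,\infty)$ be a continuous function for which there exist constants $c_f,C_f>0$ and $\gamma>0$ such that $$c_f\,\xi^{-\gamma}\le f(\xi)\le C_f\,\xi^{-\gamma}\qquad\text{for all }\xi>0 .$$ Suppose that the problem $$-\left(|u'|^{p-2}u'\right)'=\left(c_f m^+(x)-C_f m^-(x)\right)u^{-\gamma}\ \text{ in }\Omega,\qquad u>0\ \text{ in }\Omega,\qquad u=0\ \text{ on }\partial\Omega$$ has a solution. Then there exists a solution of $$-\left(|u'|^{p-2}u'\right)'=m(x)f(u)\ \text{ in }\Omega,\qquad u>0\ \text{ in }\Omega,\qquad u=0\ \text{ on }\partial\Omega .$$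
   Context: $m^+:=\max(m,0)$ and $m^-:=\max(-m,0)$, so $m=m^+-m^-$. A solution of a problem $-(|u'|^{p-2}u')'=F(x,u)$ in $\Omega$, $u>0$ in $\Omega$, $u=0$ on $\partial\Omega$ (with $F:\Omega\times(0,\infty)\to\mathbb{R}$ a Carathéodory function) is a function $u\in C^1(\Omega)\cap C(\overline\Omega)$ with $u>0$ in $\Omega$, $u=0$ on $\partial\Omega$, satisfying the equation in the sense of distributions: $\int_a^b|u'|^{p-2}u'\phi'=\int_a^b F(x,u)\phi$ for all $\phi\in C_c^\infty(\Omega)$. *)

theory Defs
  imports "HOL-Analysis.Analysis"
begin

definition in_Lp :: "real \<Rightarrow> real set \<Rightarrow> (real \<Rightarrow> real) \<Rightarrow> bool" where
  "in_Lp q S g \<longleftrightarrow>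
     g \<in> borel_measurable (lebesgue_on S) \<and>
     integrable (lebesgue_on S) (\<lambda>x. \<bar>g x\<bar> powr q)"

text \<open>Elements of $C_c^\infty(S)$, extended by zero to the whole line.\<close>

definition test_function :: "real set \<Rightarrow> (real \<Rightarrow> real) \<Rightarrow> bool" where
  "test_function S \<phi> \<longleftrightarrow>
     (\<forall>k. ((deriv ^^ k) \<phi>) differentiable_on UNIV) \<and>
     compact (closure {x. \<phi> x \<noteq> 0}) \<and>
     closure {x. \<phi> x \<noteq> 0} \<subseteq> S"

text \<open>Positive solutions of $-(|u'|^{p-2}u')' = F(x,u)$ on $(a,b)$ with zero boundary values,
  in the sense of distributions. The integrability condition on the right-hand side says that
  $F(\cdot,u)$ defines a distribution; without it a non-integrable integrand would silently
  receive the Bochner integral 0. The left-hand integrand is continuous with compact support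
  in $(a,b)$. It vanishes where $u' = 0$, also for $p < 2$, since \<^term>\<open>0 powr s = (0::real)\<close>.\<close>

definition dirichlet_solution ::
    "real \<Rightarrow> real \<Rightarrow> real \<Rightarrow> (real \<Rightarrow> real \<Rightarrow> real) \<Rightarrow> (real \<Rightarrow> real) \<Rightarrow> bool" where
  "dirichlet_solution p a b F u \<longleftrightarrow>
     u C1_differentiable_on {a<..<b} \<and>
     continuous_on {a..b} u \<and>
     (\<forall>x\<in>{a<..<b}. u x > 0) \<and> u a = 0 \<and> u b = 0 \<and>
     (\<forall>\<phi>. test_function {a<..<b} \<phi> \<longrightarrow>
        set_integrable lebesgue {a<..<b} (\<lambda>x. F x (u x) * \<phi> x) \<and>
        (LINT x:{a<..<b}|lebesgue. \<bar>deriv u x\<bar> powr (p - 2) * deriv u x * deriv \<phi> x) =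
        (LINT x:{a<..<b}|lebesgue. F x (u x) * \<phi> x))"

end

theory Submission
  imports Defs "HOL-Complex_Analysis.Great_Picard"
begin

text \<open>With the flux \<open>z = |u'|\<^sup>p\<^sup>-\<^sup>2 u'\<close> the equation is the first-order system
  \<open>u' = |z|\<^sup>r sgn z\<close>, \<open>z' = -F(x,u)\<close>, where \<open>r = 1/(p-1)\<close>. The given solution \<open>v\<close> is a
  subsolution of the target problem. A supersolution \<open>w\<close> above it is a multiple of a power of the
  solution \<open>\<psi>\<close> of \<open>-(|\<psi>'|\<^sup>p\<^sup>-\<^sup>2 \<psi>')' = |m| + 1\<close>. On compact subintervals the right-hand side
  \<open>m f(max v u)\<close> is dominated by an integrable function. There the boundary value problem is solved
  by shooting for the equation with a small delay, whose initial value problem is uniquely solvable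
  although \<open>f\<close> is merely continuous, and by removing the delay. One-dimensional comparison puts the
  solution between \<open>v\<close> and \<open>w\<close>, which makes the truncation \<open>max v u\<close> invisible; an exhaustion of
  the interval gives the solution, and \<open>w\<close> forces the zero boundary values.\<close>

section \<open>Signed powers and integration by parts\<close>

text \<open>The weights in the given problem are the worst case of the bounds on \<open>f\<close>:
  the lower bound where \<open>m\<close> is positive, the upper one where it is negative. Since
  \<open>f\<close> need not be monotone, two solutions of the target equation cannot be compared
  with each other. Every comparison is made against \<open>v\<close> or \<open>w\<close>, and only
  where the wanted order fails: below \<open>v\<close> the truncated right-hand side is frozen at
  \<open>m f(v)\<close>, and above \<open>w\<close> it is dominated by
  \<open>C * max m 0 * s powr (- \<gamma>)\<close>, which is nonincreasing in \<open>s\<close>. As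
  \<open>m\<close> is merely integrable, a flux need not be differentiable, so equations are kept in
  the integrated form \<open>(g has_integral (z x - z y)) {x..y}\<close>. The distributional form
  enters only at the two ends: the lemma of du Bois-Reymond leads into the integrated form,
  integration by parts leads back. No integrability of the right-hand side up to \<open>a\<close>
  and \<open>b\<close> is available, so all bounds used for the final limit are local. The delay
  turns each shooting problem into a finite iteration, continuous in the initial flux, and the
  intermediate value theorem takes the place of a fixed point theorem.\<close>

text \<open>The flux of the p-Laplacian is \<open>spow (p - 1)\<close> applied to the derivative,
  and \<open>spow (1 / (p - 1))\<close> is its inverse. Writing it with \<open>sgn\<close> gives the
  value 0 at 0 for every exponent.\<close>

definition spow :: "real \<Rightarrow> real \<Rightarrow> real" where
  "spow r s = sgn s * \<bar>s\<bar> powr r"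

lemma spow_zero [simp]: "spow r 0 = 0"
  by (simp add: spow_def)

lemma spow_minus: "spow r (- s) = - spow r s"
  by (simp add: spow_def sgn_minus)

lemma spow_nonneg: "0 \<le> s \<Longrightarrow> spow r s = s powr r"
  by (cases "s = 0") (auto simp: spow_def)

lemma spow_pos: "0 < s \<Longrightarrow> 0 < spow r s"
  by (simp add: spow_nonneg)

lemma spow_neg: "s < 0 \<Longrightarrow> spow r s < 0"
  using spow_pos[of "- s" r] by (simp add: spow_minus)

lemma abs_spow: "\<bar>spow r s\<bar> = \<bar>s\<bar> powr r"
  by (cases "s = 0") (auto simp: spow_def abs_mult)

lemma spow_inverse:
  assumes "r * q = 1"
  shows "spow q (spow r s) = s"
proof (cases "s = 0")
  case False
  then have "sgn (spow r s) = sgn s"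
    by (simp add: spow_def sgn_mult)
  then have "spow q (spow r s) = sgn s * (\<bar>s\<bar> powr r) powr q"
    by (metis abs_spow spow_def)
  then show ?thesis
    using assms by (simp add: powr_powr mult_sgn_abs)
qed simp

lemma spow_strict_mono:
  assumes "0 < r" "s < t"
  shows "spow r s < spow r t"
proof -
  consider "0 \<le> s" | "s < 0" "0 \<le> t" | "t < 0"
    by linarith
  then show ?thesis
  proof cases
    case 1
    with assms show ?thesis by (simp add: spow_nonneg powr_less_mono2)
  next
    case 2
    then have "spow r s < 0" "0 \<le> spow r t"
      by (auto simp: spow_neg spow_nonneg)
    then show ?thesis by linarith
  next
    case 3
    then have "(- t) powr r < (- s) powr r"
      using assms by (intro powr_less_mono2) auto
    then show ?thesis
      using 3 assms spow_minus[of r "- t"] spow_minus[of r "- s"] by (simp add: spow_nonneg)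
  qed
qed

lemma spow_mono: "0 < r \<Longrightarrow> s \<le> t \<Longrightarrow> spow r s \<le> spow r t"
  using spow_strict_mono[of r s t] by (cases "s = t") auto

lemma continuous_on_spow:
  assumes "0 < r" "continuous_on S g"
  shows "continuous_on S (\<lambda>x. spow r (g x))"
proof -
  \<comment> \<open>Both bases are nonnegative, so continuity of \<open>powr\<close> for nonnegative
    bases and positive exponents also covers the zeros of \<open>g\<close>.\<close>
  have eq: "spow r s = (max s 0) powr r - (max (- s) 0) powr r" for s
    by (cases s "0 :: real" rule: linorder_cases) (auto simp: spow_def max_def)
  show ?thesis
    unfolding eq using assms
    by (intro continuous_intros continuous_on_powr') auto
qed

lemma tendsto_spow:
  assumes "0 < r" "(g \<longlongrightarrow> l) F"
  shows "((\<lambda>x. spow r (g x)) \<longlongrightarrow> spow r l) F"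
proof -
  have "continuous_on UNIV (spow r)"
    using continuous_on_spow[OF assms(1) continuous_on_id] by simp
  then show ?thesis
    using assms(2) by (metis UNIV_I continuous_on_eq_continuous_at isCont_tendsto_compose open_UNIV)
qed

lemma spow_mult_pos: "0 < k \<Longrightarrow> spow r (k * s) = k powr r * spow r s"
  by (simp add: spow_def sgn_mult abs_mult powr_mult)

section \<open>Absolute integrability and integration by parts for an indefinite integral\<close>

lemma absolutely_integrable_mult_continuous:
  fixes g h :: "real \<Rightarrow> real"
  assumes "g absolutely_integrable_on {c..d}" "continuous_on {c..d} h"
  shows "(\<lambda>x. g x * h x) absolutely_integrable_on {c..d}"
proof -
  have "(\<lambda>x. h x * g x) absolutely_integrable_on {c..d}"
  proof (rule absolutely_integrable_bounded_measurable_product_real)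
    show "h \<in> borel_measurable (lebesgue_on {c..d})"
      using assms(2) by (intro continuous_imp_measurable_on_sets_lebesgue) auto
    show "bounded (h ` {c..d})"
      using assms(2) by (intro compact_imp_bounded compact_continuous_image) auto
  qed (use assms in auto)
  then show ?thesis by (simp add: mult.commute)
qed

text \<open>Passes from the Lebesgue integrals over the open interval in the weak formulation to
  gauge integrals over a compact interval outside which the test function vanishes.\<close>

lemma zero_extension_set_integral:
  fixes g :: "real \<Rightarrow> real"
  assumes "g absolutely_integrable_on {c..d}" "{c..d} \<subseteq> S" "\<And>x. x \<in> S \<Longrightarrow> x \<notin> {c..d} \<Longrightarrow> g x = 0"
  shows "set_integrable lebesgue S g" "(LINT x:S|lebesgue. g x) = integral {c..d} g"
proof -
  have eq: "(\<lambda>x. indicator S x *\<^sub>R g x) = (\<lambda>x. indicator {c..d} x *\<^sub>R g x)"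
    using assms(2,3) by (auto simp: indicator_def fun_eq_iff)
  show "set_integrable lebesgue S g"
    using assms(1) unfolding set_integrable_def eq .
  have "(LINT x:S|lebesgue. g x) = (LINT x:{c..d}|lebesgue. g x)"
    unfolding set_lebesgue_integral_def eq ..
  then show "(LINT x:S|lebesgue. g x) = integral {c..d} g"
    using set_lebesgue_integral_eq_integral(2)[OF assms(1)] by simp
qed

lemma in_Lp_imp_absolutely_integrable:
  assumes "1 \<le> q" "in_Lp q {a<..<b} g"
  shows "g absolutely_integrable_on {a..b}"
proof -
  have "g absolutely_integrable_on {a<..<b}"
  proof (rule measurable_bounded_by_integrable_imp_absolutely_integrable)
    show "g \<in> borel_measurable (lebesgue_on {a<..<b})"
      using assms(2) by (simp add: in_Lp_def)
    have "(\<lambda>x. \<bar>g x\<bar> powr q) integrable_on {a<..<b}"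
      using assms(2) unfolding in_Lp_def by (intro integrable_on_lebesgue_on) auto
    moreover have "(\<lambda>x. 1 :: real) integrable_on {a<..<b}"
      by (simp add: integrable_on_Icc_iff_Ioo[symmetric] integrable_const_ivl)
    ultimately show "(\<lambda>x. 1 + \<bar>g x\<bar> powr q) integrable_on {a<..<b}"
      by (intro Henstock_Kurzweil_Integration.integrable_add)
    fix x
    show "norm (g x) \<le> 1 + \<bar>g x\<bar> powr q"
    proof (cases "\<bar>g x\<bar> \<le> 1")
      case True
      then show ?thesis by (simp add: add_increasing2)
    next
      case False
      then have "\<bar>g x\<bar> powr 1 \<le> \<bar>g x\<bar> powr q"
        using assms(1) by (intro powr_mono) auto
      with False show ?thesis by simp
    qed
  qed auto
  then show ?thesis
    by (simp add: absolutely_integrable_on_Icc_iff_Ioo)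
qed

text \<open>A substitute for "zero derivative implies constant" in which increments are measured by
  \<open>W\<close> instead of by length. Summing over a partition of mesh below
  \<open>\<delta>\<close> telescopes on both sides and leaves \<open>\<epsilon>\<close> times the
  fixed number \<open>W d - W c\<close>.\<close>

lemma eq_if_increment_negligible:
  fixes R W :: "real \<Rightarrow> real"
  assumes "c \<le> d"
    and small: "\<And>\<epsilon>. 0 < \<epsilon> \<Longrightarrow> \<exists>\<delta>>0. \<forall>x y. c \<le> x \<longrightarrow> x \<le> y \<longrightarrow> y \<le> d \<longrightarrow> y - x < \<delta> \<longrightarrow>
                   \<bar>R y - R x\<bar> \<le> \<epsilon> * (W y - W x)"
  shows "R d = R c"
proof -
  have bound: "\<bar>R d - R c\<bar> \<le> \<epsilon> * (W d - W c)" if \<epsilon>: "0 < \<epsilon>" for \<epsilon>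
  proof -
    obtain \<delta> where \<delta>: "0 < \<delta>" "\<And>x y. c \<le> x \<Longrightarrow> x \<le> y \<Longrightarrow> y \<le> d \<Longrightarrow> y - x < \<delta> \<Longrightarrow>
        \<bar>R y - R x\<bar> \<le> \<epsilon> * (W y - W x)"
      using small[OF \<epsilon>] by meson
    obtain n :: nat where n: "(d - c) / \<delta> < n"
      using reals_Archimedean2 by blast
    have n0: "0 < n"
    proof (rule ccontr)
      assume "\<not> 0 < n"
      then have "(d - c) / \<delta> < 0" using n by simp
      then show False using assms(1) \<delta>(1) by (simp add: divide_less_0_iff)
    qed
    define t where "t i = c + (d - c) * real i / real n" for i
    have t: "c \<le> t i" for i
      using assms(1) by (simp add: t_def)
    have step: "t (Suc i) - t i = (d - c) / n" for i
      using n0 by (simp add: t_def field_simps)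
    have "(d - c) / n < \<delta>"
      using n \<delta>(1) n0 by (simp add: divide_less_eq mult.commute)
    moreover have "t (Suc i) \<le> d" if "i < n" for i
    proof -
      have "(d - c) * (real (Suc i) / n) \<le> (d - c) * 1"
        using assms(1) that n0 by (intro mult_left_mono) auto
      then show ?thesis by (simp add: t_def)
    qed
    moreover have "t i \<le> t (Suc i)" for i
    proof -
      have "0 \<le> (d - c) / n" using assms(1) by simp
      then show ?thesis using step[of i] by linarith
    qed
    ultimately have "\<bar>R (t (Suc i)) - R (t i)\<bar> \<le> \<epsilon> * (W (t (Suc i)) - W (t i))" if "i < n" for i
      using \<delta>(2) t step that by simp
    then have "(\<Sum>i<n. \<bar>R (t (Suc i)) - R (t i)\<bar>) \<le> (\<Sum>i<n. \<epsilon> * (W (t (Suc i)) - W (t i)))"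
      by (intro sum_mono) auto
    also have "\<dots> = \<epsilon> * (W (t n) - W (t 0))"
      by (simp add: sum_distrib_left[symmetric] sum_lessThan_telescope[of "\<lambda>i. W (t i)"])
    finally have "\<bar>\<Sum>i<n. R (t (Suc i)) - R (t i)\<bar> \<le> \<epsilon> * (W (t n) - W (t 0))"
      by (rule order_trans[OF sum_abs])
    moreover have "t n = d" "t 0 = c"
      using n0 by (auto simp: t_def)
    ultimately show ?thesis
      by (simp add: sum_lessThan_telescope[of "\<lambda>i. R (t i)"])
  qed
  have "\<bar>R d - R c\<bar> \<le> 0"
  proof (rule field_le_epsilon)
    fix e :: real assume "0 < e"
    define k where "k = \<bar>W d - W c\<bar> + 1"
    have "\<bar>R d - R c\<bar> \<le> e / k * (W d - W c)"
      using \<open>0 < e\<close> by (intro bound) (auto simp: k_def)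
    also have "\<dots> \<le> e / k * k"
      using \<open>0 < e\<close> by (intro mult_left_mono) (auto simp: k_def)
    finally show "\<bar>R d - R c\<bar> \<le> 0 + e"
      by (simp add: k_def)
  qed
  then show ?thesis by simp
qed

text \<open>The hypothesis is the integrated form of \<open>- z' = g\<close>, the shape in which all
  flux equations are stated; the order \<open>z x - z y\<close> accounts for the minus sign.\<close>

lemma continuous_on_indefinite:
  fixes g z :: "real \<Rightarrow> real"
  assumes "\<And>x y. c \<le> x \<Longrightarrow> x \<le> y \<Longrightarrow> y \<le> d \<Longrightarrow> (g has_integral (z x - z y)) {x..y}"
  shows "continuous_on {c..d} z"
proof (cases "c \<le> d")
  case True
  have "continuous_on {c..d} (\<lambda>x. z c - integral {c..x} g)"
    using assms[of c d] True by (intro continuous_intros indefinite_integral_continuous_1) auto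
  then show ?thesis
  proof (rule continuous_on_eq)
    show "z c - integral {c..x} g = z x" if "x \<in> {c..d}" for x
      using assms[of c x] that by (simp add: integral_unique)
  qed
qed simp

text \<open>Since \<open>z\<close> need not be differentiable, the product rule is replaced by the estimate
  \<open>z y h y - z x h x = \<integral> z y h' - \<integral> h x g\<close> over a short interval \<open>[x,y]\<close>, whose difference
  from the claimed integral is small compared with \<open>y - x + \<integral>\<bar>g\<bar>\<close>.\<close>

lemma integration_by_parts_indefinite:
  fixes g h h' z :: "real \<Rightarrow> real"
  assumes "c \<le> d"
    and z: "\<And>x y. c \<le> x \<Longrightarrow> x \<le> y \<Longrightarrow> y \<le> d \<Longrightarrow> (g has_integral (z x - z y)) {x..y}"
    and g: "g absolutely_integrable_on {c..d}"
    and h: "\<And>x. x \<in> {c..d} \<Longrightarrow> (h has_real_derivative h' x) (at x within {c..d})"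
    and h': "continuous_on {c..d} h'"
  shows "((\<lambda>t. z t * h' t - g t * h t) has_integral (z d * h d - z c * h c)) {c..d}"
proof -
  have cz: "continuous_on {c..d} z"
    using z by (rule continuous_on_indefinite)
  have ch: "continuous_on {c..d} h"
    using h by (metis DERIV_continuous continuous_on_eq_continuous_within)
  define F where "F t = z t * h' t - g t * h t" for t
  have gh: "(\<lambda>t. g t * h t) integrable_on {c..d}"
    using absolutely_integrable_mult_continuous[OF g ch] set_lebesgue_integral_eq_integral(1) by blast
  have zh: "(\<lambda>t. z t * h' t) integrable_on {c..d}"
    using cz h' by (intro integrable_continuous_real continuous_intros)
  have F: "F integrable_on {c..d}"
    unfolding F_def using zh gh by (rule Henstock_Kurzweil_Integration.integrable_diff)
  have ag: "(\<lambda>t. \<bar>g t\<bar>) integrable_on {c..d}"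
    using g by (simp add: absolutely_integrable_on_def)
  have "bounded (h' ` {c..d})"
    using h' by (intro compact_imp_bounded compact_continuous_image) auto
  then obtain M where M: "\<And>t. t \<in> {c..d} \<Longrightarrow> \<bar>h' t\<bar> \<le> M"
    unfolding bounded_iff real_norm_def by blast
  \<comment> \<open>\<open>R\<close> is the defect of the claimed formula, which says exactly
    \<open>R d = R c\<close>. The weight \<open>W\<close> collects the two error sources:
    \<open>M\<close> bounds \<open>h'\<close>, and the oscillation of \<open>h\<close> is multiplied
    by the absolute value of \<open>g\<close>.\<close>
  define R where "R x = integral {c..x} F - z x * h x" for x
  define W where "W x = M * x + integral {c..x} (\<lambda>t. \<bar>g t\<bar>)" for x
  have "R d = R c"
  proof (rule eq_if_increment_negligible[OF \<open>c \<le> d\<close>])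
    fix \<epsilon> :: real assume "0 < \<epsilon>"
    obtain \<delta>1 where \<delta>1: "0 < \<delta>1" "\<And>s t. s \<in> {c..d} \<Longrightarrow> t \<in> {c..d} \<Longrightarrow> \<bar>t - s\<bar> < \<delta>1 \<Longrightarrow> \<bar>z t - z s\<bar> < \<epsilon>"
      using compact_uniformly_continuous[OF cz compact_Icc] \<open>0 < \<epsilon>\<close>
      unfolding uniformly_continuous_on_def dist_real_def by meson
    obtain \<delta>2 where \<delta>2: "0 < \<delta>2" "\<And>s t. s \<in> {c..d} \<Longrightarrow> t \<in> {c..d} \<Longrightarrow> \<bar>t - s\<bar> < \<delta>2 \<Longrightarrow> \<bar>h t - h s\<bar> < \<epsilon>"
      using compact_uniformly_continuous[OF ch compact_Icc] \<open>0 < \<epsilon>\<close>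
      unfolding uniformly_continuous_on_def dist_real_def by meson
    have "\<bar>R y - R x\<bar> \<le> \<epsilon> * (W y - W x)"
      if xy: "c \<le> x" "x \<le> y" "y \<le> d" and yx: "y - x < min \<delta>1 \<delta>2" for x y
    proof -
      have sub: "{x..y} \<subseteq> {c..d}"
        using xy by auto
      have "integral {c..y} F = integral {c..x} F + integral {x..y} F"
        using xy F integrable_on_subinterval[of F "{c..d}" c y] Henstock_Kurzweil_Integration.integral_combine[of c x y F] by simp
      then have RR: "R y - R x = integral {x..y} F - (z y * h y - z x * h x)"
        by (simp add: R_def)
      have "integral {c..y} (\<lambda>t. \<bar>g t\<bar>) = integral {c..x} (\<lambda>t. \<bar>g t\<bar>) + integral {x..y} (\<lambda>t. \<bar>g t\<bar>)"
        using xy ag integrable_on_subinterval[of "\<lambda>t. \<bar>g t\<bar>" "{c..d}" c y]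
          Henstock_Kurzweil_Integration.integral_combine[of c x y "\<lambda>t. \<bar>g t\<bar>"] by simp
      then have WW: "W y - W x = M * (y - x) + integral {x..y} (\<lambda>t. \<bar>g t\<bar>)"
        by (simp add: W_def algebra_simps)
      have agxy: "(\<lambda>t. \<bar>g t\<bar>) integrable_on {x..y}"
        using ag sub integrable_on_subinterval by blast
      have "(h' has_integral (h y - h x)) {x..y}"
      proof (intro fundamental_theorem_of_calculus)
        show "(h has_vector_derivative h' t) (at t within {x..y})" if "t \<in> {x..y}" for t
          using DERIV_subset[OF h sub, of t] that sub
          unfolding has_real_derivative_iff_has_vector_derivative by blast
      qed (use xy in auto)
      then have 1: "((\<lambda>t. z y * h' t) has_integral z y * (h y - h x)) {x..y}"
        by (rule has_integral_mult_right)
      have 2: "((\<lambda>t. h x * g t) has_integral h x * (z x - z y)) {x..y}"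
        by (intro has_integral_mult_right z xy)
      have RR3: "integral {x..y} F - (z y * (h y - h x) - h x * (z x - z y))
          = integral {x..y} F - (z y * h y - z x * h x)"
        by (simp add: algebra_simps)
      have 3: "(F has_integral integral {x..y} F) {x..y}"
        using F sub integrable_on_subinterval by (metis integrable_integral)
      have "((\<lambda>t. F t - (z y * h' t - h x * g t)) has_integral (R y - R x)) {x..y}"
        unfolding RR RR3[symmetric]
        by (rule Henstock_Kurzweil_Integration.has_integral_diff
            [OF 3 Henstock_Kurzweil_Integration.has_integral_diff[OF 1 2]])
      then have "R y - R x = integral {x..y} (\<lambda>t. F t - (z y * h' t - h x * g t))"
        and int: "(\<lambda>t. F t - (z y * h' t - h x * g t)) integrable_on {x..y}"
        by (auto simp: has_integral_iff)
      note this(1)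
      also have "norm (integral {x..y} (\<lambda>t. F t - (z y * h' t - h x * g t)))
          \<le> integral {x..y} (\<lambda>t. \<epsilon> * (M + \<bar>g t\<bar>))"
      proof (rule Henstock_Kurzweil_Integration.integral_norm_bound_integral[OF int])
        fix t assume t: "t \<in> {x..y}"
        then have td: "t \<in> {c..d}" using sub by auto
        have "F t - (z y * h' t - h x * g t) = (z t - z y) * h' t + (h x - h t) * g t"
          by (simp add: F_def algebra_simps)
        also have "\<bar>\<dots>\<bar> \<le> \<bar>z t - z y\<bar> * \<bar>h' t\<bar> + \<bar>h x - h t\<bar> * \<bar>g t\<bar>"
          by (metis abs_mult abs_triangle_ineq)
        also have "\<dots> \<le> \<epsilon> * M + \<epsilon> * \<bar>g t\<bar>"
        proof (intro add_mono mult_mono)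
          show "\<bar>z t - z y\<bar> \<le> \<epsilon>"
            using t td xy yx by (intro less_imp_le \<delta>1(2)) auto
          show "\<bar>h x - h t\<bar> \<le> \<epsilon>"
            using t td xy yx by (intro less_imp_le \<delta>2(2)) auto
        qed (use M[OF td] \<open>0 < \<epsilon>\<close> in auto)
        finally show "norm (F t - (z y * h' t - h x * g t)) \<le> \<epsilon> * (M + \<bar>g t\<bar>)"
          by (simp add: algebra_simps)
      qed (intro integrable_on_mult_right Henstock_Kurzweil_Integration.integrable_add integrable_const_ivl agxy)
      also have "\<dots> = \<epsilon> * (M * (y - x) + integral {x..y} (\<lambda>t. \<bar>g t\<bar>))"
      proof -
        have "integral {x..y} (\<lambda>t. M + \<bar>g t\<bar>) = M * (y - x) + integral {x..y} (\<lambda>t. \<bar>g t\<bar>)"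
          using Henstock_Kurzweil_Integration.integral_add[OF integrable_const_ivl agxy, of M] xy(2)
          by (simp add: mult.commute)
        then show ?thesis by simp
      qed
      finally show ?thesis by (simp add: WW)
    qed
    then show "\<exists>\<delta>>0. \<forall>x y. c \<le> x \<longrightarrow> x \<le> y \<longrightarrow> y \<le> d \<longrightarrow> y - x < \<delta> \<longrightarrow>
                   \<bar>R y - R x\<bar> \<le> \<epsilon> * (W y - W x)"
      using \<delta>1(1) \<delta>2(1) by (intro exI[of _ "min \<delta>1 \<delta>2"]) auto
  qed
  then have "integral {c..d} F = z d * h d - z c * h c"
    by (simp add: R_def)
  then show ?thesis
    using F unfolding F_def by (simp add: has_integral_iff)
qed

section \<open>Comparison and compactness\<close>

text \<open>At an interior positive maximum of \<open>u - v\<close> the fluxes agree, so to its left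
  \<open>u' \<le> v'\<close> as long as \<open>u > v\<close>; hence \<open>u - v\<close> cannot come down to a zero there.\<close>

lemma flux_comparison:
  fixes u v zu zv :: "real \<Rightarrow> real"
  assumes r: "0 < r" and cd: "c \<le> d"
    and cu: "continuous_on {c..d} u" and cv: "continuous_on {c..d} v"
    and du: "\<And>x. c < x \<Longrightarrow> x < d \<Longrightarrow> (u has_real_derivative spow r (zu x)) (at x)"
    and dv: "\<And>x. c < x \<Longrightarrow> x < d \<Longrightarrow> (v has_real_derivative spow r (zv x)) (at x)"
    and flux: "\<And>x y. c < x \<Longrightarrow> x \<le> y \<Longrightarrow> y < d \<Longrightarrow> (\<And>t. t \<in> {x..y} \<Longrightarrow> v t < u t) \<Longrightarrow>
                 zu x - zu y \<le> zv x - zv y"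
    and bc: "u c \<le> v c" "u d \<le> v d" and x: "x \<in> {c..d}"
  shows "u x \<le> v x"
proof (rule ccontr)
  assume neg: "\<not> u x \<le> v x"
  define D where "D t = u t - v t" for t
  have cD: "continuous_on {c..d} D"
    unfolding D_def using cu cv by (intro continuous_intros)
  obtain m where m: "m \<in> {c..d}" "\<And>t. t \<in> {c..d} \<Longrightarrow> D t \<le> D m"
    using continuous_attains_sup[OF compact_Icc _ cD] x by auto
  have Dm: "0 < D m"
    using m(2)[OF x] neg by (simp add: D_def)
  then have mcd: "c < m" "m < d"
    using m(1) bc by (auto simp: D_def less_le)
  \<comment> \<open>The supremum \<open>\<alpha>\<close> of \<open>Z\<close> is the last point
    before \<open>m\<close> at which \<open>u\<close> does not exceed \<open>v\<close>. On the
    interval between \<open>\<alpha>\<close> and \<open>m\<close> the flux hypothesis is therefore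
    available.\<close>
  define Z where "Z = {t \<in> {c..m}. D t \<le> 0}"
  have "continuous_on {c..m} D"
    using cD mcd continuous_on_subset by fastforce
  then have "closed Z"
    unfolding Z_def by (intro continuous_on_closed_Collect_le continuous_on_const) auto
  have Zc: "c \<in> Z"
    using mcd bc by (auto simp: Z_def D_def)
  have "bdd_above Z"
    by (rule bdd_aboveI[of _ m]) (auto simp: Z_def)
  define \<alpha> where "\<alpha> = Sup Z"
  have \<alpha>Z: "\<alpha> \<in> Z"
    unfolding \<alpha>_def using Zc \<open>bdd_above Z\<close> \<open>closed Z\<close> by (intro closed_contains_Sup) auto
  then have \<alpha>: "c \<le> \<alpha>" "\<alpha> < m" "D \<alpha> \<le> 0"
    using Dm by (auto simp: Z_def less_le)
  have pos: "0 < D t" if "\<alpha> < t" "t \<le> m" for t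
  proof (rule ccontr)
    assume "\<not> 0 < D t"
    then have "t \<in> Z" using that \<alpha> by (auto simp: Z_def)
    then have "t \<le> \<alpha>"
      unfolding \<alpha>_def using \<open>bdd_above Z\<close> by (rule cSup_upper)
    then show False using that by simp
  qed
  have dD: "(D has_real_derivative spow r (zu t) - spow r (zv t)) (at t)" if "c < t" "t < d" for t
    unfolding D_def using du[OF that] dv[OF that] by (rule DERIV_diff)
  have "spow r (zu m) - spow r (zv m) = 0"
  proof (rule DERIV_local_max[OF dD[OF mcd]])
    show "0 < min (m - c) (d - m)" using mcd by simp
    show "\<forall>y. \<bar>m - y\<bar> < min (m - c) (d - m) \<longrightarrow> D y \<le> D m"
      by (intro allI impI m(2)) auto
  qed
  then have zm: "zu m = zv m"
    using spow_strict_mono[OF r] by (metis eq_iff_diff_eq_0 linorder_less_linear order_less_irrefl)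
  have "D m \<le> D \<alpha>"
  proof (rule DERIV_nonpos_imp_decreasing_open[of \<alpha> m])
    show "\<alpha> \<le> m" using \<alpha> by simp
    show "\<exists>y. (D has_real_derivative y) (at t) \<and> y \<le> 0" if t: "\<alpha> < t" "t < m" for t
    proof (intro exI conjI)
      show "(D has_real_derivative spow r (zu t) - spow r (zv t)) (at t)"
        using t mcd \<alpha> by (intro dD) auto
      have "zu t - zu m \<le> zv t - zv m"
      proof (rule flux)
        show "v s < u s" if "s \<in> {t..m}" for s
          using pos[of s] that t by (simp add: D_def)
      qed (use t mcd \<alpha> in auto)
      then show "spow r (zu t) - spow r (zv t) \<le> 0"
        using zm spow_mono[OF r, of "zu t" "zv t"] by simp
    qed
    show "continuous_on {\<alpha>..m} D"
      using cD \<alpha> mcd by (auto intro: continuous_on_subset)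
  qed
  then show False using Dm \<alpha> by simp
qed

text \<open>The Arzela-Ascoli argument on a set that need not be compact: a diagonal subsequence
  converges on a countable dense subset, and equicontinuity spreads the Cauchy property. The
  threshold \<open>N\<close> may depend on the point, because near a point of an open interval the
  approximations are controlled only from some index on.\<close>

lemma equicontinuous_pointwise_convergent_subsequence:
  fixes g :: "nat \<Rightarrow> real \<Rightarrow> real"
  assumes bounded: "\<And>x. x \<in> S \<Longrightarrow> \<exists>M. \<forall>n. \<bar>g n x\<bar> \<le> M"
    and equicont: "\<And>x \<epsilon>. x \<in> S \<Longrightarrow> 0 < \<epsilon> \<Longrightarrow>
      \<exists>\<delta>>0. \<exists>N. \<forall>n\<ge>N. \<forall>y\<in>S. \<bar>y - x\<bar> < \<delta> \<longrightarrow> \<bar>g n y - g n x\<bar> < \<epsilon>"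
  obtains \<rho> where "strict_mono (\<rho> :: nat \<Rightarrow> nat)" "\<And>x. x \<in> S \<Longrightarrow> convergent (\<lambda>n. g (\<rho> n) x)"
proof -
  obtain T where T: "countable T" "T \<subseteq> S" "S \<subseteq> closure T"
    by (rule separable)
  obtain M where M: "\<And>x n. x \<in> S \<Longrightarrow> \<bar>g n x\<bar> \<le> M x"
    using bounded by metis
  \<comment> \<open>Dividing by \<open>K\<close> turns the pointwise bounds into the common bound 1
    that the diagonal theorem asks for; the added 1 keeps the divisor positive.\<close>
  define K where "K x = \<bar>M x\<bar> + 1" for x
  have K: "0 < K x" for x by (simp add: K_def add_nonneg_pos)
  have gK: "\<bar>g n x\<bar> \<le> K x" if "x \<in> S" for x n
    using M[OF that, of n] by (simp add: K_def)
  obtain \<rho> :: "nat \<Rightarrow> nat" where \<rho>: "strict_mono \<rho>"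
    and lim: "\<And>x. x \<in> T \<Longrightarrow> \<exists>l. (\<lambda>n. g (\<rho> n) x / K x) \<longlonglongrightarrow> l"
  proof (rule function_convergent_subsequence[of T "\<lambda>n x. g n x / K x" 1])
    show "norm (g n x / K x) \<le> 1" if "x \<in> T" for n x
      using gK[of x n] that T K[of x] by auto
  qed (use T in auto)
  have convT: "Cauchy (\<lambda>n. g (\<rho> n) x)" if x: "x \<in> T" for x
  proof -
    obtain l where "(\<lambda>n. g (\<rho> n) x / K x) \<longlonglongrightarrow> l" using lim[OF x] by blast
    then have "(\<lambda>n. K x * (g (\<rho> n) x / K x)) \<longlonglongrightarrow> K x * l"
      by (intro tendsto_intros)
    then have "(\<lambda>n. g (\<rho> n) x) \<longlonglongrightarrow> K x * l"
      using K[of x] by simp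
    then show ?thesis by (rule LIMSEQ_imp_Cauchy)
  qed
  have "convergent (\<lambda>n. g (\<rho> n) x)" if x: "x \<in> S" for x
  proof (rule real_Cauchy_convergent, rule CauchyI)
    fix \<epsilon> :: real assume "0 < \<epsilon>"
    then have "0 < \<epsilon> / 3" by simp
    then obtain \<delta> N where \<delta>: "0 < \<delta>" and
      N: "\<And>n y. n \<ge> N \<Longrightarrow> y \<in> S \<Longrightarrow> \<bar>y - x\<bar> < \<delta> \<Longrightarrow> \<bar>g n y - g n x\<bar> < \<epsilon> / 3"
      using equicont[OF x] by metis
    obtain y where y: "y \<in> T" "\<bar>y - x\<bar> < \<delta>"
      using subsetD[OF T(3) x] \<delta> unfolding closure_approachable dist_real_def by blast
    obtain N' where N': "\<And>i j. i \<ge> N' \<Longrightarrow> j \<ge> N' \<Longrightarrow> \<bar>g (\<rho> i) y - g (\<rho> j) y\<bar> < \<epsilon> / 3"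
      using CauchyD[OF convT[OF y(1)] \<open>0 < \<epsilon> / 3\<close>] by auto
    have "\<bar>g (\<rho> i) x - g (\<rho> j) x\<bar> < \<epsilon>" if "i \<ge> max N N'" "j \<ge> max N N'" for i j
    proof -
      have "\<rho> i \<ge> N" "\<rho> j \<ge> N"
        using that seq_suble[OF \<rho>, of i] seq_suble[OF \<rho>, of j] by auto
      then have "\<bar>g (\<rho> i) y - g (\<rho> i) x\<bar> < \<epsilon> / 3" "\<bar>g (\<rho> j) y - g (\<rho> j) x\<bar> < \<epsilon> / 3"
        using N y T by auto
      then show ?thesis using N'[of i j] that by linarith
    qed
    then show "\<exists>M. \<forall>m\<ge>M. \<forall>n\<ge>M. norm (g (\<rho> m) x - g (\<rho> n) x) < \<epsilon>"
      by (intro exI[of _ "max N N'"]) auto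
  qed
  then show thesis using that \<rho> by blast
qed

section \<open>Boundary value problems by delayed shooting\<close>

text \<open>Serves twice: with \<open>H\<close> constant 1 for the torsion function, and with
  \<open>H x s = f (max (v x) s)\<close> for the truncated problem. Keeping the integrable weight
  \<open>m\<close> apart from the bounded continuous \<open>H\<close> gives one majorant,
  \<open>K\<close> times the absolute value of \<open>m\<close>, for all iterates.\<close>

locale bounded_rhs =
  fixes c d r K :: real and m :: "real \<Rightarrow> real" and H :: "real \<Rightarrow> real \<Rightarrow> real"
  assumes cd: "c < d" and r: "0 < r"
    and m: "m absolutely_integrable_on {c..d}"
    and H: "continuous_on ({c..d} \<times> UNIV) (\<lambda>(x, s). H x s)"
    and HK: "\<And>x s. x \<in> {c..d} \<Longrightarrow> \<bar>H x s\<bar> \<le> K"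
begin

text \<open>\<open>e\<close> is the delay. Before \<open>c + e\<close> the history of
  \<open>u\<close> is taken to be its value at \<open>c\<close>.\<close>

definition rhs :: "real \<Rightarrow> (real \<Rightarrow> real) \<Rightarrow> real \<Rightarrow> real" where
  "rhs e u s = m s * H s (u (max c (s - e)))"

definition flux :: "real \<Rightarrow> real \<Rightarrow> (real \<Rightarrow> real) \<Rightarrow> real \<Rightarrow> real" where
  "flux e k u t = k - integral {c..t} (rhs e u)"

text \<open>The Picard map of the delayed system with initial value \<open>A\<close> and initial
  flux \<open>k\<close>; the latter is the shooting parameter.\<close>

definition step :: "real \<Rightarrow> real \<Rightarrow> real \<Rightarrow> (real \<Rightarrow> real) \<Rightarrow> real \<Rightarrow> real" where
  "step A e k u x = A + integral {c..x} (\<lambda>t. spow r (flux e k u t))"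

text \<open>Bounds the drift of a flux from its initial value, uniformly in \<open>u\<close>, the
  delay and \<open>k\<close>.\<close>

definition total :: real where
  "total = integral {c..d} (\<lambda>s. K * \<bar>m s\<bar>)"

lemma tendsto_H:
  assumes "x \<in> {c..d}" "f \<longlonglongrightarrow> l"
  shows "(\<lambda>n. H x (f n)) \<longlonglongrightarrow> H x l"
proof -
  have "continuous_on UNIV (H x)"
  proof -
    have "continuous_on UNIV (\<lambda>s. (\<lambda>(x, s). H x s) (x, s))"
      using assms(1) by (intro continuous_on_compose2[OF H] continuous_intros) auto
    then show ?thesis by simp
  qed
  then show ?thesis
    using assms(2) by (metis UNIV_I continuous_on_eq_continuous_at isCont_tendsto_compose open_UNIV)
qed

lemma continuous_on_delay:
  assumes "continuous_on {c..d} u" "0 \<le> e"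
  shows "continuous_on {c..d} (\<lambda>s. u (max c (s - e)))"
  using cd assms(2) by (intro continuous_on_compose2[OF assms(1)] continuous_intros) auto

lemma absolutely_integrable_mult_H:
  assumes "continuous_on {c..d} w"
  shows "(\<lambda>s. m s * H s (w s)) absolutely_integrable_on {c..d}"
proof (rule absolutely_integrable_mult_continuous[OF m])
  show "continuous_on {c..d} (\<lambda>s. H s (w s))"
  proof -
    have "continuous_on {c..d} (\<lambda>s. (\<lambda>(x, s). H x s) (s, w s))"
      using assms by (intro continuous_on_compose2[OF H] continuous_intros) auto
    then show ?thesis by simp
  qed
qed

lemma rhs_integrable:
  assumes "continuous_on {c..d} u" "0 \<le> e" "t \<in> {c..d}"
  shows "rhs e u integrable_on {c..t}"
proof -
  have "rhs e u integrable_on {c..d}"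
    unfolding rhs_def
    by (intro set_lebesgue_integral_eq_integral(1) absolutely_integrable_mult_H continuous_on_delay assms)
  then show ?thesis
    using assms(3) by (auto intro: integrable_on_subinterval)
qed

lemma rhs_bound: "s \<in> {c..d} \<Longrightarrow> \<bar>rhs e u s\<bar> \<le> K * \<bar>m s\<bar>"
  using mult_left_mono[OF HK[of s "u (max c (s - e))"], of "\<bar>m s\<bar>"]
  by (simp add: rhs_def abs_mult mult.commute)

lemma dominant_integrable: "t \<in> {c..d} \<Longrightarrow> (\<lambda>s. K * \<bar>m s\<bar>) integrable_on {c..t}"
proof -
  assume t: "t \<in> {c..d}"
  have "(\<lambda>s. \<bar>m s\<bar>) integrable_on {c..d}"
    using m by (simp add: absolutely_integrable_on_def)
  then show ?thesis
    using t by (intro integrable_on_mult_right) (auto intro: integrable_on_subinterval)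
qed

lemma flux_bound:
  assumes "continuous_on {c..d} u" "0 \<le> e" "t \<in> {c..d}"
  shows "\<bar>flux e k u t - k\<bar> \<le> total"
proof -
  have "0 \<le> K"
    using HK[of c 0] cd by simp
  have "norm (integral {c..t} (rhs e u)) \<le> integral {c..t} (\<lambda>s. K * \<bar>m s\<bar>)"
    using rhs_bound assms
    by (intro Henstock_Kurzweil_Integration.integral_norm_bound_integral
        rhs_integrable dominant_integrable) auto
  also have "\<dots> \<le> total"
    unfolding total_def using assms cd \<open>0 \<le> K\<close>
    by (intro integral_subset_le dominant_integrable) auto
  finally show ?thesis by (simp add: flux_def)
qed

lemma flux_continuous:
  assumes "continuous_on {c..d} u" "0 \<le> e"
  shows "continuous_on {c..d} (flux e k u)"
  unfolding flux_def using rhs_integrable[OF assms, of d] cd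
  by (intro continuous_intros indefinite_integral_continuous_1) auto

lemma spow_flux_continuous:
  assumes "continuous_on {c..d} u" "0 \<le> e"
  shows "continuous_on {c..d} (\<lambda>t. spow r (flux e k u t))"
  by (intro continuous_on_spow r flux_continuous assms)

lemma step_continuous:
  assumes "continuous_on {c..d} u" "0 \<le> e"
  shows "continuous_on {c..d} (step A e k u)"
  unfolding step_def using spow_flux_continuous[OF assms]
  by (intro continuous_intros indefinite_integral_continuous_1 integrable_continuous_real)

text \<open>The constant involves neither \<open>u\<close> nor \<open>e\<close>, so it passes to all
  fixed points with initial flux bounded by \<open>J\<close> and yields equicontinuity while the
  delay tends to 0.\<close>

lemma step_lipschitz:
  assumes u: "continuous_on {c..d} u" "0 \<le> e" and "\<bar>k\<bar> \<le> J" "x \<in> {c..d}" "y \<in> {c..d}"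
  shows "\<bar>step A e k u y - step A e k u x\<bar> \<le> (J + total) powr r * \<bar>y - x\<bar>"
proof -
  have *: "\<bar>step A e k u y - step A e k u x\<bar> \<le> (J + total) powr r * (y - x)"
    if xy: "x \<in> {c..d}" "y \<in> {c..d}" "x \<le> y" for x y
  proof -
    let ?f = "\<lambda>t. spow r (flux e k u t)"
    have int: "?f integrable_on {c..d}"
      by (intro integrable_continuous_real spow_flux_continuous u)
    have "integral {c..x} ?f + integral {x..y} ?f = integral {c..y} ?f"
      using xy int
      by (intro Henstock_Kurzweil_Integration.integral_combine) (auto intro: integrable_on_subinterval)
    then have "step A e k u y - step A e k u x = integral {x..y} ?f"
      by (simp add: step_def)
    also have "norm \<dots> \<le> (J + total) powr r * (y - x)"
    proof (rule integral_bound)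
      show "continuous_on {x..y} ?f"
        by (rule continuous_on_subset[OF spow_flux_continuous[OF u]]) (use xy in auto)
      show "norm (?f t) \<le> (J + total) powr r" if "t \<in> {x..y}" for t
      proof -
        have "\<bar>flux e k u t\<bar> \<le> J + total"
          using flux_bound[OF u, of t k] that xy assms(3) by auto
        then have "\<bar>flux e k u t\<bar> powr r \<le> (J + total) powr r"
          using r by (intro powr_mono2) auto
        then show ?thesis by (simp add: abs_spow)
      qed
    qed (use xy in auto)
    finally show ?thesis by simp
  qed
  show ?thesis
    using *[of x y] *[of y x] assms by (cases "x \<le> y") (auto simp: abs_minus_commute)
qed

text \<open>Two nested dominated convergences, the inner one for the flux and the outer one for its
  signed power. The delay may vary with \<open>n\<close>, so that the result covers both continuity
  in \<open>k\<close> at a fixed delay and the removal of the delay; for this reason only the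
  delayed values are required to converge.\<close>

lemma step_limit:
  assumes u: "\<And>n. continuous_on {c..d} (u n)" and e: "\<And>n. 0 \<le> e n" and k: "k \<longlonglongrightarrow> k'"
    and w: "\<And>s. s \<in> {c..d} \<Longrightarrow> (\<lambda>n. u n (max c (s - e n))) \<longlonglongrightarrow> w s"
    and x: "x \<in> {c..d}"
  shows "(\<lambda>n. step A (e n) (k n) (u n) x) \<longlonglongrightarrow>
           A + integral {c..x} (\<lambda>t. spow r (k' - integral {c..t} (\<lambda>s. m s * H s (w s))))"
proof -
  have flux: "(\<lambda>n. flux (e n) (k n) (u n) t) \<longlonglongrightarrow> k' - integral {c..t} (\<lambda>s. m s * H s (w s))"
    if t: "t \<in> {c..d}" for t
  proof -
    have "(\<lambda>n. integral {c..t} (rhs (e n) (u n))) \<longlonglongrightarrow> integral {c..t} (\<lambda>s. m s * H s (w s))"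
    proof (rule Equivalence_Lebesgue_Henstock_Integration.dominated_convergence(2))
      show "rhs (e n) (u n) integrable_on {c..t}" for n
        by (intro rhs_integrable u e t)
      show "(\<lambda>s. K * \<bar>m s\<bar>) integrable_on {c..t}"
        by (rule dominant_integrable[OF t])
      show "norm (rhs (e n) (u n) s) \<le> K * \<bar>m s\<bar>" if "s \<in> {c..t}" for n s
        using rhs_bound that t by auto
      show "(\<lambda>n. rhs (e n) (u n) s) \<longlonglongrightarrow> m s * H s (w s)" if "s \<in> {c..t}" for s
        unfolding rhs_def using that t by (intro tendsto_intros tendsto_H w) auto
    qed
    then show ?thesis
      unfolding flux_def by (intro tendsto_diff k)
  qed
  obtain M where M: "\<And>n. \<bar>k n\<bar> \<le> M"
    using convergent_imp_Bseq[of k] k by (auto simp: convergent_def Bseq_def)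
  have "(\<lambda>n. integral {c..x} (\<lambda>t. spow r (flux (e n) (k n) (u n) t))) \<longlonglongrightarrow>
      integral {c..x} (\<lambda>t. spow r (k' - integral {c..t} (\<lambda>s. m s * H s (w s))))"
  proof (rule Equivalence_Lebesgue_Henstock_Integration.dominated_convergence(2))
    show "(\<lambda>t. spow r (flux (e n) (k n) (u n) t)) integrable_on {c..x}" for n
      using x by (intro integrable_continuous_real continuous_on_subset[OF spow_flux_continuous[OF u e]]) auto
    show "(\<lambda>t. (M + total) powr r) integrable_on {c..x}"
      by (rule integrable_const_ivl)
    show "norm (spow r (flux (e n) (k n) (u n) t)) \<le> (M + total) powr r" if "t \<in> {c..x}" for n t
    proof -
      have "\<bar>flux (e n) (k n) (u n) t\<bar> \<le> M + total"
        using flux_bound[OF u[of n] e[of n], of t "k n"] M[of n] that x by auto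
      then show ?thesis
        using r by (auto simp: abs_spow intro!: powr_mono2)
    qed
    show "(\<lambda>n. spow r (flux (e n) (k n) (u n) t)) \<longlonglongrightarrow>
        spow r (k' - integral {c..t} (\<lambda>s. m s * H s (w s)))" if "t \<in> {c..x}" for t
      using that x by (intro tendsto_spow r flux) auto
  qed
  then show ?thesis
    unfolding step_def by (intro tendsto_intros)
qed

definition iter :: "real \<Rightarrow> real \<Rightarrow> real \<Rightarrow> nat \<Rightarrow> real \<Rightarrow> real" where
  "iter A e k j = (step A e k ^^ j) (\<lambda>_. A)"

lemma iter_0 [simp]: "iter A e k 0 = (\<lambda>_. A)"
  and iter_Suc: "iter A e k (Suc j) = step A e k (iter A e k j)"
  by (simp_all add: iter_def)

lemma iter_continuous: "0 \<le> e \<Longrightarrow> continuous_on {c..d} (iter A e k j)"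
  by (induction j) (auto simp: iter_Suc intro: step_continuous)

text \<open>The value of a step at \<open>x\<close> only depends on the past up to \<open>x - e\<close>, so the iteration
  becomes stationary on one more interval of length \<open>e\<close> in each round.\<close>

lemma iter_stationary:
  assumes "0 \<le> e" "x \<in> {c..d}" "x \<le> c + real j * e"
  shows "iter A e k (Suc j) x = iter A e k j x"
  using assms(2,3)
proof (induction j arbitrary: x)
  case 0
  then have x: "x = c" by simp
  show ?case unfolding x by (simp add: iter_Suc step_def)
next
  case (Suc j)
  have "rhs e (iter A e k (Suc j)) s = rhs e (iter A e k j) s" if "s \<in> {c..x}" for s
  proof -
    have "iter A e k (Suc j) (max c (s - e)) = iter A e k j (max c (s - e))"
      using that Suc.prems assms(1) cd by (intro Suc.IH) (auto simp: algebra_simps)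
    then show ?thesis by (simp add: rhs_def)
  qed
  then have "flux e k (iter A e k (Suc j)) t = flux e k (iter A e k j) t" if "t \<in> {c..x}" for t
    unfolding flux_def using that by (auto intro!: Henstock_Kurzweil_Integration.integral_cong)
  then have "step A e k (iter A e k (Suc j)) x = step A e k (iter A e k j) x"
    unfolding step_def by (auto intro!: Henstock_Kurzweil_Integration.integral_cong)
  then show ?case by (simp add: iter_Suc)
qed

text \<open>Here the delay pays off: a fixed finite number of steps is continuous in
  \<open>k\<close> by induction, with no uniqueness theorem for the undelayed equation.\<close>

lemma iter_continuous_parameter:
  assumes "0 \<le> e" "x \<in> {c..d}"
  shows "continuous_on UNIV (\<lambda>k. iter A e k j x)"
  using assms(2)
proof (induction j arbitrary: x)
  case (Suc j)
  show ?case
    unfolding continuous_on_sequentially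
  proof (intro allI ballI impI)
    fix k :: "nat \<Rightarrow> real" and k' assume k: "(\<forall>n. k n \<in> UNIV) \<and> k \<longlonglongrightarrow> k'"
    have lim: "(\<lambda>n. iter A e (k n) j (max c (s - e))) \<longlonglongrightarrow> iter A e k' j (max c (s - e))"
      if "s \<in> {c..d}" for s
    proof -
      have "continuous_on UNIV (\<lambda>k. iter A e k j (max c (s - e)))"
        using that assms(1) cd by (intro Suc.IH) auto
      from continuous_on_tendsto_compose[OF this conjunct2[OF k]] show ?thesis by simp
    qed
    have "(\<lambda>n. step A e (k n) (iter A e (k n) j) x) \<longlonglongrightarrow>
        A + integral {c..x} (\<lambda>t. spow r (k' - integral {c..t}
          (\<lambda>s. m s * H s (iter A e k' j (max c (s - e))))))"
      by (rule step_limit[OF iter_continuous[OF assms(1)] assms(1) conjunct2[OF k] lim Suc.prems])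
    then show "((\<lambda>k. iter A e k (Suc j) x) \<circ> k) \<longlonglongrightarrow> iter A e k' (Suc j) x"
      by (simp add: iter_Suc o_def step_def[of A e k'] flux_def[of e k'] rhs_def[abs_def])
  qed
qed simp

text \<open>A constant flux \<open>\<kappa> = (\<bar>B - A\<bar> / (d - c)) powr (1 / r)\<close>
  would raise \<open>u\<close> by \<open>\<bar>B - A\<bar>\<close> over the interval. Fluxes stay
  within \<open>total\<close> of their initial value, so \<open>k = total + \<kappa>\<close> ends at
  or above \<open>B\<close> and its negative at or below \<open>B\<close>. The index
  \<open>Suc j\<close> exposes the integral formula of a step.\<close>

lemma iter_hits:
  assumes e: "0 \<le> e"
  obtains k where "\<bar>k\<bar> \<le> total + (\<bar>B - A\<bar> / (d - c)) powr (1 / r)" "iter A e k (Suc j) d = B"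
proof -
  define \<kappa> where "\<kappa> = (\<bar>B - A\<bar> / (d - c)) powr (1 / r)"
  have \<kappa>: "spow r \<kappa> = \<bar>B - A\<bar> / (d - c)" "0 \<le> \<kappa>"
    using cd r by (auto simp: \<kappa>_def spow_nonneg powr_powr)
  have total: "0 \<le> total"
    using order_trans[OF abs_ge_zero flux_bound[OF continuous_on_const order_refl, of c 0 0]] cd by simp
  have int: "(\<lambda>t. spow r (flux e k (iter A e k j) t)) integrable_on {c..d}" for k
    by (intro integrable_continuous_real spow_flux_continuous iter_continuous e)
  have fb: "\<bar>flux e k (iter A e k j) t - k\<bar> \<le> total" if "t \<in> {c..d}" for k t
    by (intro flux_bound iter_continuous e that)
  have const: "integral {c..d} (\<lambda>t. spow r \<kappa>) = \<bar>B - A\<bar>"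
    using cd \<kappa> by simp
  have "integral {c..d} (\<lambda>t. spow r \<kappa>) \<le>
      integral {c..d} (\<lambda>t. spow r (flux e (total + \<kappa>) (iter A e (total + \<kappa>) j) t))"
  proof (intro integral_le int integrable_const_ivl spow_mono r)
    fix t assume "t \<in> {c..d}"
    then show "\<kappa> \<le> flux e (total + \<kappa>) (iter A e (total + \<kappa>) j) t"
      using fb[of t "total + \<kappa>"] by linarith
  qed
  then have hi: "B \<le> iter A e (total + \<kappa>) (Suc j) d"
    unfolding const by (simp add: iter_Suc step_def)
  have "integral {c..d} (\<lambda>t. spow r (flux e (- (total + \<kappa>)) (iter A e (- (total + \<kappa>)) j) t)) \<le>
      integral {c..d} (\<lambda>t. spow r (- \<kappa>))"
  proof (intro integral_le int integrable_const_ivl spow_mono r)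
    fix t assume "t \<in> {c..d}"
    then show "flux e (- (total + \<kappa>)) (iter A e (- (total + \<kappa>)) j) t \<le> - \<kappa>"
      using fb[of t "- (total + \<kappa>)"] by linarith
  qed
  also have "\<dots> = - \<bar>B - A\<bar>"
    using cd \<kappa> by (simp add: spow_minus)
  finally have lo: "iter A e (- (total + \<kappa>)) (Suc j) d \<le> B"
    by (simp add: iter_Suc step_def)
  have "continuous_on {- (total + \<kappa>)..total + \<kappa>} (\<lambda>k. iter A e k (Suc j) d)"
    using iter_continuous_parameter[OF e, of d A "Suc j"] cd by (auto intro: continuous_on_subset)
  then obtain k where "- (total + \<kappa>) \<le> k" "k \<le> total + \<kappa>" "iter A e k (Suc j) d = B"
    using IVT'[of "\<lambda>k. iter A e k (Suc j) d", OF lo hi] total \<kappa>(2) by force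
  then show thesis
    by (intro that[of k]) (simp_all add: \<kappa>_def)
qed

theorem boundary_value_solution:
  obtains u z where
    "\<And>x. x \<in> {c..d} \<Longrightarrow> (u has_real_derivative spow r (z x)) (at x within {c..d})"
    "\<And>x y. c \<le> x \<Longrightarrow> x \<le> y \<Longrightarrow> y \<le> d \<Longrightarrow> ((\<lambda>s. m s * H s (u s)) has_integral (z x - z y)) {x..y}"
    "u c = A" "u d = B"
proof -
  define J where "J = total + (\<bar>B - A\<bar> / (d - c)) powr (1 / r)"
  define L where "L = (J + total) powr r"
  \<comment> \<open>With this delay \<open>n + 1\<close> rounds of stationarity cover the whole
    interval, which makes \<open>U n\<close> a genuine fixed point of its step map
    (\<open>fix_U\<close>).\<close>
  define e where "e n = (d - c) / real (Suc n)" for n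
  have e0: "0 \<le> e n" for n using cd by (simp add: e_def)
  have "\<exists>k. \<bar>k\<bar> \<le> J \<and> iter A (e n) k (Suc n) d = B" for n
    unfolding J_def by (rule iter_hits[OF e0]) blast
  then obtain k where k: "\<And>n. \<bar>k n\<bar> \<le> J" "\<And>n. iter A (e n) (k n) (Suc n) d = B"
    by metis
  define U where "U n = iter A (e n) (k n) (Suc n)" for n
  have cU: "continuous_on {c..d} (U n)" for n
    unfolding U_def by (intro iter_continuous e0)
  have fix_U: "step A (e n) (k n) (U n) x = U n x" if "x \<in> {c..d}" for n x
    using iter_stationary[OF e0 that, of "Suc n" n A "k n"] that
    by (simp add: U_def iter_Suc[of _ _ _ "Suc n"] e_def)
  have lip: "\<bar>U n y - U n x\<bar> \<le> L * \<bar>y - x\<bar>" if "x \<in> {c..d}" "y \<in> {c..d}" for n x y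
    using step_lipschitz[OF cU[of n] e0[of n] k(1)[of n] that, of A]
    unfolding fix_U[OF that(1)] fix_U[OF that(2)] L_def .
  have Uc: "U n c = A" for n
    by (simp add: U_def iter_Suc step_def)
  obtain \<sigma> l where \<sigma>: "strict_mono \<sigma>" "(k \<circ> \<sigma>) \<longlonglongrightarrow> l"
  proof -
    have "bounded (range k)"
      using k(1) by (intro boundedI[of _ J]) auto
    then show thesis
      using bounded_imp_convergent_subsequence that by blast
  qed
  have "\<exists>\<rho>. strict_mono \<rho> \<and> (\<forall>x\<in>{c..d}. convergent (\<lambda>n. U (\<sigma> (\<rho> n)) x))"
  proof (rule equicontinuous_pointwise_convergent_subsequence[of "{c..d}" "\<lambda>n. U (\<sigma> n)"])
    fix x assume x: "x \<in> {c..d}"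
    show "\<exists>M. \<forall>n. \<bar>U (\<sigma> n) x\<bar> \<le> M"
    proof (intro exI allI)
      fix n show "\<bar>U (\<sigma> n) x\<bar> \<le> \<bar>A\<bar> + L * \<bar>x - c\<bar>"
        using lip[of c x "\<sigma> n"] x cd Uc[of "\<sigma> n"] by simp
    qed
    fix \<epsilon> :: real assume "0 < \<epsilon>"
    have L: "0 \<le> L" by (simp add: L_def)
    show "\<exists>\<delta>>0. \<exists>N. \<forall>n\<ge>N. \<forall>y\<in>{c..d}. \<bar>y - x\<bar> < \<delta> \<longrightarrow> \<bar>U (\<sigma> n) y - U (\<sigma> n) x\<bar> < \<epsilon>"
    proof (intro exI conjI allI ballI impI)
      show "0 < \<epsilon> / (L + 1)" using \<open>0 < \<epsilon>\<close> L by simp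
      fix n y assume y: "y \<in> {c..d}" "\<bar>y - x\<bar> < \<epsilon> / (L + 1)"
      have "\<bar>U (\<sigma> n) y - U (\<sigma> n) x\<bar> \<le> L * \<bar>y - x\<bar>" using lip x y by blast
      also have "\<dots> \<le> (L + 1) * \<bar>y - x\<bar>" by (simp add: mult_right_mono)
      also have "\<dots> < \<epsilon>" using y L by (simp add: less_divide_eq mult.commute)
      finally show "\<bar>U (\<sigma> n) y - U (\<sigma> n) x\<bar> < \<epsilon>" .
    qed
  qed blast
  then obtain \<rho> where \<rho>: "strict_mono \<rho>" "\<And>x. x \<in> {c..d} \<Longrightarrow> convergent (\<lambda>n. U (\<sigma> (\<rho> n)) x)"
    by blast
  define \<tau> where "\<tau> n = \<sigma> (\<rho> n)" for n
  have \<tau>: "strict_mono \<tau>"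
    using \<sigma>(1) \<rho>(1) by (simp add: \<tau>_def strict_mono_def)
  have k\<tau>: "(\<lambda>n. k (\<tau> n)) \<longlonglongrightarrow> l"
    using LIMSEQ_subseq_LIMSEQ[OF \<sigma>(2) \<rho>(1)] by (simp add: o_def \<tau>_def)
  define u where "u x = lim (\<lambda>n. U (\<tau> n) x)" for x
  have u: "(\<lambda>n. U (\<tau> n) x) \<longlonglongrightarrow> u x" if "x \<in> {c..d}" for x
    using \<rho>(2)[OF that] by (simp add: u_def \<tau>_def convergent_LIMSEQ_iff)
  have "e \<longlonglongrightarrow> 0"
    unfolding e_def using LIMSEQ_Suc[OF lim_const_over_n[of "d - c"]] by simp
  then have e\<tau>: "(\<lambda>n. e (\<tau> n)) \<longlonglongrightarrow> 0"
    using LIMSEQ_subseq_LIMSEQ[OF _ \<tau>, of e 0] by (simp add: o_def)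
  \<comment> \<open>The common Lipschitz constant \<open>L\<close> makes the error of the shifted
    argument at most \<open>L\<close> times the shift, so delayed and undelayed values have the same
    limit.\<close>
  have delayed: "(\<lambda>n. U (\<tau> n) (max c (s - e (\<tau> n)))) \<longlonglongrightarrow> u s" if s: "s \<in> {c..d}" for s
  proof -
    have "(\<lambda>n. U (\<tau> n) (max c (s - e (\<tau> n))) - U (\<tau> n) s) \<longlonglongrightarrow> 0"
    proof (rule Lim_null_comparison)
      show "\<forall>\<^sub>F n in sequentially. norm (U (\<tau> n) (max c (s - e (\<tau> n))) - U (\<tau> n) s)
          \<le> L * \<bar>max c (s - e (\<tau> n)) - s\<bar>"
      proof (intro always_eventually allI)
        fix n
        have "max c (s - e (\<tau> n)) \<in> {c..d}"
          using s cd e0[of "\<tau> n"] by auto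
        then show "norm (U (\<tau> n) (max c (s - e (\<tau> n))) - U (\<tau> n) s)
            \<le> L * \<bar>max c (s - e (\<tau> n)) - s\<bar>"
          using lip[OF s] by simp
      qed
      have "(\<lambda>n. L * \<bar>max c (s - e (\<tau> n)) - s\<bar>) \<longlonglongrightarrow> L * \<bar>max c (s - 0) - s\<bar>"
        by (intro tendsto_intros e\<tau>)
      then show "(\<lambda>n. L * \<bar>max c (s - e (\<tau> n)) - s\<bar>) \<longlonglongrightarrow> 0"
        using s by simp
    qed
    from tendsto_add[OF this u[OF s]] show ?thesis by simp
  qed
  define z where "z t = l - integral {c..t} (\<lambda>s. m s * H s (u s))" for t
  have uz: "u x = A + integral {c..x} (\<lambda>t. spow r (z t))" if x: "x \<in> {c..d}" for x
  proof (rule LIMSEQ_unique[OF u[OF x]])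
    have "(\<lambda>n. step A (e (\<tau> n)) (k (\<tau> n)) (U (\<tau> n)) x) \<longlonglongrightarrow>
        A + integral {c..x} (\<lambda>t. spow r (l - integral {c..t} (\<lambda>s. m s * H s (u s))))"
      by (rule step_limit[OF cU e0 k\<tau> delayed x])
    then show "(\<lambda>n. U (\<tau> n) x) \<longlonglongrightarrow> A + integral {c..x} (\<lambda>t. spow r (z t))"
      using fix_U[OF x] by (simp add: z_def)
  qed
  have lipu: "\<bar>u y - u x\<bar> \<le> L * \<bar>y - x\<bar>" if "x \<in> {c..d}" "y \<in> {c..d}" for x y
  proof (rule LIMSEQ_le_const2)
    show "(\<lambda>n. \<bar>U (\<tau> n) y - U (\<tau> n) x\<bar>) \<longlonglongrightarrow> \<bar>u y - u x\<bar>"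
      by (intro tendsto_intros u that)
    show "\<exists>N. \<forall>n\<ge>N. \<bar>U (\<tau> n) y - U (\<tau> n) x\<bar> \<le> L * \<bar>y - x\<bar>"
      using lip that by blast
  qed
  have cu: "continuous_on {c..d} u"
  proof (rule lipschitz_on_continuous_on)
    show "L-lipschitz_on {c..d} u"
      by (rule lipschitz_onI) (use lipu in \<open>auto simp: dist_real_def L_def\<close>)
  qed
  have int: "(\<lambda>s. m s * H s (u s)) integrable_on {c..d}"
    by (intro set_lebesgue_integral_eq_integral(1) absolutely_integrable_mult_H cu)
  have hz: "((\<lambda>s. m s * H s (u s)) has_integral (z x - z y)) {x..y}"
    if "c \<le> x" "x \<le> y" "y \<le> d" for x y
  proof -
    have "integral {c..x} (\<lambda>s. m s * H s (u s)) + integral {x..y} (\<lambda>s. m s * H s (u s))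
        = integral {c..y} (\<lambda>s. m s * H s (u s))"
      using that int
      by (intro Henstock_Kurzweil_Integration.integral_combine) (auto intro: integrable_on_subinterval)
    moreover have "(\<lambda>s. m s * H s (u s)) integrable_on {x..y}"
      using that int by (auto intro: integrable_on_subinterval)
    ultimately show ?thesis
      by (simp add: has_integral_iff z_def)
  qed
  have cz: "continuous_on {c..d} z"
    using hz by (rule continuous_on_indefinite)
  show thesis
  proof (rule that[of u z])
    show "(u has_real_derivative spow r (z x)) (at x within {c..d})" if x: "x \<in> {c..d}" for x
    proof (rule has_field_derivative_transform_within[OF _ zero_less_one x])
      show "((\<lambda>x. A + integral {c..x} (\<lambda>t. spow r (z t))) has_real_derivative spow r (z x))
          (at x within {c..d})"
        using integral_has_real_derivative[OF continuous_on_spow[OF r cz] x]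
        by (auto intro!: derivative_eq_intros)
    qed (simp add: uz)
    show "u c = A" using uz[of c] cd by simp
    have "(\<lambda>n. U (\<tau> n) d) \<longlonglongrightarrow> B" using k(2) by (simp add: U_def)
    then show "u d = B" using u[of d] cd LIMSEQ_unique by auto
  qed (rule hz)
qed

end

section \<open>A supersolution\<close>

text \<open>Since \<open>\<mu>\<close> is at least 1, the flux is strictly decreasing. Hence
  \<open>\<psi>\<close> increases on the left of a point with nonnegative flux and decreases on the
  right of a point with negative flux; either way its value exceeds the boundary value on that
  side.\<close>

lemma dirichlet_torsion:
  fixes \<mu> :: "real \<Rightarrow> real"
  assumes ab: "a < b" and r: "0 < r" and \<mu>: "\<mu> absolutely_integrable_on {a..b}"
    and pos: "\<And>x. x \<in> {a..b} \<Longrightarrow> 1 \<le> \<mu> x"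
  obtains \<psi> z where
    "\<And>x. x \<in> {a..b} \<Longrightarrow> (\<psi> has_real_derivative spow r (z x)) (at x within {a..b})"
    "\<And>x y. a \<le> x \<Longrightarrow> x \<le> y \<Longrightarrow> y \<le> b \<Longrightarrow> (\<mu> has_integral (z x - z y)) {x..y}"
    "\<psi> a = 0" "\<psi> b = 0" "\<And>x. a < x \<Longrightarrow> x < b \<Longrightarrow> 0 < \<psi> x"
proof -
  interpret bounded_rhs a b r 1 \<mu> "\<lambda>_ _. 1"
    by unfold_locales (use ab r \<mu> in \<open>auto simp: case_prod_unfold intro!: continuous_intros\<close>)
  obtain \<psi> z where
    \<psi>: "\<And>x. x \<in> {a..b} \<Longrightarrow> (\<psi> has_real_derivative spow r (z x)) (at x within {a..b})" and
    z: "\<And>x y. a \<le> x \<Longrightarrow> x \<le> y \<Longrightarrow> y \<le> b \<Longrightarrow> ((\<lambda>s. \<mu> s * 1) has_integral (z x - z y)) {x..y}" and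
    bc: "\<psi> a = 0" "\<psi> b = 0"
    by (rule boundary_value_solution[where A=0 and B=0]) blast
  have z: "(\<mu> has_integral (z x - z y)) {x..y}" if "a \<le> x" "x \<le> y" "y \<le> b" for x y
    using z[OF that] by simp
  have decr: "z y < z x" if "a \<le> x" "x < y" "y \<le> b" for x y
  proof -
    have "((\<lambda>t. 1) has_integral (y - x)) {x..y}"
      using has_integral_const_real[of "1 :: real" x y] that by simp
    from has_integral_le[OF this z[of x y]] have "y - x \<le> z x - z y"
      using that pos by auto
    then show ?thesis using that by simp
  qed
  have c\<psi>: "continuous_on {a..b} \<psi>"
    using \<psi> by (metis DERIV_continuous continuous_on_eq_continuous_within)
  have \<psi>': "(\<psi> has_real_derivative spow r (z x)) (at x)" if "a < x" "x < b" for x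
    using \<psi>[of x] that by (simp add: at_within_Icc_at)
  have "0 < \<psi> x" if x: "a < x" "x < b" for x
  proof (cases "0 \<le> z x")
    case True
    have "\<psi> a < \<psi> x"
    proof (rule DERIV_pos_imp_increasing_open[of a x \<psi>])
      show "\<exists>y. (\<psi> has_real_derivative y) (at t) \<and> 0 < y" if "a < t" "t < x" for t
        using \<psi>'[of t] spow_pos[of "z t" r] decr[of t x] that x True by auto
      show "continuous_on {a..x} \<psi>"
        using x by (intro continuous_on_subset[OF c\<psi>]) auto
    qed (rule x)
    then show ?thesis using bc by simp
  next
    case False
    have "\<psi> b < \<psi> x"
    proof (rule DERIV_neg_imp_decreasing_open[of x b \<psi>])
      show "\<exists>y. (\<psi> has_real_derivative y) (at t) \<and> y < 0" if "x < t" "t < b" for t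
        using \<psi>'[of t] spow_neg[of "z t" r] decr[of x t] that x False by auto
      show "continuous_on {x..b} \<psi>"
        using x by (intro continuous_on_subset[OF c\<psi>]) auto
    qed (rule x)
    then show ?thesis using bc by simp
  qed
  with \<psi> z bc show thesis by (rule that)
qed

text \<open>The powers \<open>w = K \<psi>\<^sup>\<alpha>\<close> have flux \<open>\<kappa> \<psi>\<^sup>-\<^sup>q z\<close> with \<open>q = \<alpha> \<gamma>\<close>. Differentiating
  \<open>\<psi>\<^sup>-\<^sup>q\<close> produces a term of the right sign, and what is left is
  \<open>\<kappa> \<mu> \<psi>\<^sup>-\<^sup>q \<ge> C m w\<^sup>-\<^sup>\<gamma>\<close>.\<close>

lemma singular_supersolution:
  fixes m :: "real \<Rightarrow> real"
  assumes ab: "a < b" and r: "0 < r" and \<gamma>: "0 < \<gamma>" and C: "0 < C"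
    and m: "m absolutely_integrable_on {a..b}"
  obtains w z G where
    "continuous_on {a..b} w" "w a = 0" "w b = 0" "\<And>x. a < x \<Longrightarrow> x < b \<Longrightarrow> 0 < w x"
    "\<And>x. a < x \<Longrightarrow> x < b \<Longrightarrow> (w has_real_derivative spow r (z x)) (at x)"
    "\<And>x y. a < x \<Longrightarrow> x \<le> y \<Longrightarrow> y < b \<Longrightarrow> (G has_integral (z x - z y)) {x..y}"
    "\<And>x. a < x \<Longrightarrow> x < b \<Longrightarrow> C * max (m x) 0 * w x powr (- \<gamma>) \<le> G x"
proof -
  \<comment> \<open>The absolute value dominates the positive part of \<open>m\<close>; the added 1
    supplies the lower bound that makes \<open>\<psi>\<close> positive.\<close>
  define \<mu> where "\<mu> x = \<bar>m x\<bar> + 1" for x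
  have "(\<lambda>x. \<bar>m x\<bar>) absolutely_integrable_on {a..b}"
    using absolutely_integrable_norm[OF m] by (simp add: o_def)
  then have \<mu>: "\<mu> absolutely_integrable_on {a..b}"
    unfolding \<mu>_def
    by (rule set_integral_add(1)[OF _ absolutely_integrable_continuous_real[OF continuous_on_const]])
  obtain \<psi> \<zeta> where
    \<psi>: "\<And>x. x \<in> {a..b} \<Longrightarrow> (\<psi> has_real_derivative spow r (\<zeta> x)) (at x within {a..b})" and
    \<zeta>: "\<And>x y. a \<le> x \<Longrightarrow> x \<le> y \<Longrightarrow> y \<le> b \<Longrightarrow> (\<mu> has_integral (\<zeta> x - \<zeta> y)) {x..y}" and
    bc: "\<psi> a = 0" "\<psi> b = 0" and pos: "\<And>x. a < x \<Longrightarrow> x < b \<Longrightarrow> 0 < \<psi> x"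
    by (rule dirichlet_torsion[OF ab r \<mu>]) (auto simp: \<mu>_def)
  \<comment> \<open>The exponents of \<open>\<psi>\<close> in the derivative of \<open>w\<close> and
    in \<open>spow r (z x)\<close> are \<open>\<alpha> - 1\<close> and
    \<open>- (\<alpha> * \<gamma>) * r\<close>; this \<open>\<alpha>\<close> makes them
    equal.\<close>
  define \<alpha> where "\<alpha> = 1 / (1 + \<gamma> * r)"
  have \<gamma>r: "0 < \<gamma> * r"
    using \<gamma> r by simp
  have \<alpha>: "0 < \<alpha>" and \<alpha>q: "- (\<alpha> * \<gamma>) * r = \<alpha> - 1"
    using \<gamma>r by (auto simp: \<alpha>_def field_simps)
  \<comment> \<open>Two demands: \<open>1 \<le> K\<close> gives
    \<open>w t powr (- \<gamma>) \<le> h t\<close>, and the second entry gives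
    \<open>C \<le> \<kappa>\<close>. The constant \<open>\<kappa>\<close> is then forced by
    \<open>\<kappa> powr r = K * \<alpha>\<close>, the coefficient in the derivative of
    \<open>w\<close>.\<close>
  define K where "K = max 1 (C powr r / \<alpha>)"
  have K: "1 \<le> K" "C powr r / \<alpha> \<le> K" by (auto simp: K_def)
  define \<kappa> where "\<kappa> = (K * \<alpha>) powr (1 / r)"
  have \<kappa>0: "0 < \<kappa>" using K \<alpha> by (simp add: \<kappa>_def)
  have \<kappa>r: "\<kappa> powr r = K * \<alpha>"
    using K \<alpha> r by (simp add: \<kappa>_def powr_powr)
  have "C = (C powr r) powr (1 / r)"
    using C r by (simp add: powr_powr)
  also have "\<dots> \<le> \<kappa>"
    unfolding \<kappa>_def using K \<alpha> r by (intro powr_mono2) (auto simp: field_simps)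
  finally have C\<kappa>: "C \<le> \<kappa>" .
  define w where "w x = K * \<psi> x powr \<alpha>" for x
  define z where "z x = \<kappa> * \<psi> x powr (- (\<alpha> * \<gamma>)) * \<zeta> x" for x
  have c\<psi>: "continuous_on {a..b} \<psi>"
    using \<psi> by (metis DERIV_continuous continuous_on_eq_continuous_within)
  have \<psi>0: "0 \<le> \<psi> x" if "x \<in> {a..b}" for x
    using that bc pos[of x] by (cases "x = a \<or> x = b") (auto simp: less_le)
  have \<psi>': "(\<psi> has_real_derivative spow r (\<zeta> x)) (at x)" if "a < x" "x < b" for x
    using \<psi>[of x] that by (simp add: at_within_Icc_at)
  define h where "h t = \<psi> t powr (- (\<alpha> * \<gamma>))" for t
  define h' where "h' t = - (\<alpha> * \<gamma>) * \<psi> t powr (- (\<alpha> * \<gamma>) - 1) * spow r (\<zeta> t)" for t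
  define G where "G t = \<kappa> * (\<mu> t * h t - \<zeta> t * h' t)" for t
  show thesis
  proof (rule that[of w z G])
    show "continuous_on {a..b} w"
      unfolding w_def using c\<psi> \<psi>0 \<alpha> by (intro continuous_intros continuous_on_powr') auto
    show "w a = 0" "w b = 0" by (simp_all add: w_def bc)
    show "0 < w x" if "a < x" "x < b" for x
      using pos[OF that] K by (simp add: w_def)
    show "(w has_real_derivative spow r (z x)) (at x)" if x: "a < x" "x < b" for x
    proof -
      have "spow r (z x) = K * \<alpha> * (\<psi> x powr (- (\<alpha> * \<gamma>))) powr r * spow r (\<zeta> x)"
        unfolding z_def using \<kappa>0 pos[OF x] \<kappa>r
        by (subst spow_mult_pos) (auto simp: powr_mult)
      also have "(\<psi> x powr (- (\<alpha> * \<gamma>))) powr r = \<psi> x powr (\<alpha> - 1)"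
        using \<alpha>q by (simp add: powr_powr)
      finally have eq: "spow r (z x) = K * (\<alpha> * \<psi> x powr (\<alpha> - 1) * spow r (\<zeta> x))"
        by simp
      show ?thesis
        unfolding w_def eq
        using DERIV_cmult[OF DERIV_fun_powr[OF \<psi>'[OF x] pos[OF x], of \<alpha>], of K] by simp
    qed
    \<comment> \<open>Integration by parts is applied on interior intervals only: there
      \<open>\<psi>\<close> is bounded away from 0 and its negative power \<open>h\<close> has a
      continuous derivative.\<close>
    show "(G has_integral (z x - z y)) {x..y}" if xy: "a < x" "x \<le> y" "y < b" for x y
    proof -
      have \<psi>pos: "0 < \<psi> t" if "t \<in> {x..y}" for t
        using pos that xy by auto
      have c\<psi>': "continuous_on {x..y} \<psi>"
        using xy by (intro continuous_on_subset[OF c\<psi>]) auto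
      have c\<zeta>: "continuous_on {x..y} \<zeta>"
        using \<zeta> xy by (intro continuous_on_indefinite[of x y \<mu>]) auto
      have \<mu>': "\<mu> absolutely_integrable_on {x..y}"
        using xy by (intro absolutely_integrable_on_subinterval[OF \<mu>]) auto
      have parts: "((\<lambda>t. \<zeta> t * h' t - \<mu> t * h t) has_integral (\<zeta> y * h y - \<zeta> x * h x)) {x..y}"
      proof (rule integration_by_parts_indefinite[OF xy(2) _ \<mu>'])
        show "(\<mu> has_integral \<zeta> s - \<zeta> t) {s..t}" if "x \<le> s" "s \<le> t" "t \<le> y" for s t
          using \<zeta> that xy by simp
        show "(h has_real_derivative h' t) (at t within {x..y})" if t: "t \<in> {x..y}" for t
        proof -
          have "(h has_real_derivative h' t) (at t)"
            unfolding h_def h'_def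
            using DERIV_fun_powr[OF \<psi>'[of t] \<psi>pos[OF t], of "- (\<alpha> * \<gamma>)"] t xy by simp
          then show ?thesis by (rule has_field_derivative_at_within)
        qed
        show "continuous_on {x..y} h'"
          unfolding h'_def using \<psi>pos
          by (intro continuous_intros continuous_on_spow r c\<zeta> c\<psi>') force+
      qed
      have "(G has_integral \<kappa> * (\<zeta> x * h x - \<zeta> y * h y)) {x..y}"
        using has_integral_mult_right[OF has_integral_neg[OF parts], of \<kappa>] by (simp add: G_def[abs_def])
      moreover have "\<kappa> * (\<zeta> x * h x - \<zeta> y * h y) = z x - z y"
        by (simp add: z_def h_def algebra_simps)
      ultimately show ?thesis by simp
    qed
    show "C * max (m t) 0 * w t powr (- \<gamma>) \<le> G t" if t: "a < t" "t < b" for t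
    proof -
      have "\<zeta> t * spow r (\<zeta> t) = \<bar>\<zeta> t\<bar> * \<bar>\<zeta> t\<bar> powr r"
        by (simp add: spow_def abs_sgn mult.assoc)
      then have "0 \<le> \<alpha> * \<gamma> * \<psi> t powr (- (\<alpha> * \<gamma>) - 1) * (\<zeta> t * spow r (\<zeta> t))"
        using \<alpha> \<gamma> by simp
      then have sgn: "0 \<le> - (\<zeta> t * h' t)"
        by (simp add: h'_def algebra_simps)
      have "w t powr (- \<gamma>) = K powr (- \<gamma>) * h t"
        using K pos[OF t] by (simp add: w_def h_def powr_mult powr_powr)
      also have "\<dots> \<le> 1 * h t"
        using powr_mono[of "- \<gamma>" 0 K] K \<gamma> by (intro mult_right_mono) (auto simp: h_def)
      finally have "w t powr (- \<gamma>) \<le> h t" by simp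
      then have "C * max (m t) 0 * w t powr (- \<gamma>) \<le> \<kappa> * \<mu> t * h t"
        using C\<kappa> C by (intro mult_mono) (auto simp: \<mu>_def h_def)
      also have "\<dots> \<le> \<kappa> * (\<mu> t * h t - \<zeta> t * h' t)"
        using mult_left_mono[OF sgn, of \<kappa>] \<kappa>0 by (simp add: algebra_simps)
      finally show ?thesis unfolding G_def .
    qed
  qed
qed

section \<open>Smooth bumps and the lemma of du Bois-Reymond\<close>

text \<open>An induction-friendly form of smoothness: sums, products and affine substitutions are
  handled through a witness for the derivative, without computing iterates of \<open>deriv\<close>.
  \<open>higher_deriv_differentiable\<close> translates it back.\<close>

primrec times_differentiable :: "nat \<Rightarrow> (real \<Rightarrow> real) \<Rightarrow> bool" where
  "times_differentiable 0 f = True"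
| "times_differentiable (Suc n) f =
     (\<exists>f'. (\<forall>x. (f has_real_derivative f' x) (at x)) \<and> times_differentiable n f')"

lemma times_differentiable_SucI:
  "(\<And>x. (f has_real_derivative f' x) (at x)) \<Longrightarrow> times_differentiable n f' \<Longrightarrow>
     times_differentiable (Suc n) f"
  unfolding times_differentiable.simps by (intro exI conjI allI)

lemma times_differentiable_SucE:
  assumes "times_differentiable (Suc n) f"
  obtains f' where "\<And>x. (f has_real_derivative f' x) (at x)" "times_differentiable n f'"
  using assms unfolding times_differentiable.simps by blast

lemma times_differentiable_SucD: "times_differentiable (Suc n) f \<Longrightarrow> times_differentiable n f"
proof (induction n arbitrary: f)
  case (Suc n)
  obtain f' where f': "\<And>x. (f has_real_derivative f' x) (at x)" "times_differentiable (Suc n) f'"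
    using Suc.prems by (rule times_differentiable_SucE) (rule that)
  show ?case
    by (rule times_differentiable_SucI[OF f'(1) Suc.IH[OF f'(2)]])
qed simp

declare times_differentiable.simps(2) [simp del]

lemma times_differentiable_add:
  "times_differentiable n f \<Longrightarrow> times_differentiable n g \<Longrightarrow> times_differentiable n (\<lambda>x. f x + g x)"
proof (induction n arbitrary: f g)
  case (Suc n)
  obtain f' where f': "\<And>x. (f has_real_derivative f' x) (at x)" "times_differentiable n f'"
    using Suc.prems(1) by (rule times_differentiable_SucE) (rule that)
  obtain g' where g': "\<And>x. (g has_real_derivative g' x) (at x)" "times_differentiable n g'"
    using Suc.prems(2) by (rule times_differentiable_SucE) (rule that)
  show ?case
    by (rule times_differentiable_SucI[OF DERIV_add[OF f'(1) g'(1)] Suc.IH[OF f'(2) g'(2)]])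
qed simp

lemma times_differentiable_mult:
  "times_differentiable n f \<Longrightarrow> times_differentiable n g \<Longrightarrow> times_differentiable n (\<lambda>x. f x * g x)"
proof (induction n arbitrary: f g)
  case (Suc n)
  obtain f' where f': "\<And>x. (f has_real_derivative f' x) (at x)" "times_differentiable n f'"
    using Suc.prems(1) by (rule times_differentiable_SucE) (rule that)
  obtain g' where g': "\<And>x. (g has_real_derivative g' x) (at x)" "times_differentiable n g'"
    using Suc.prems(2) by (rule times_differentiable_SucE) (rule that)
  have "times_differentiable n (\<lambda>x. f' x * g x + g' x * f x)"
    using f'(2) g'(2) Suc.prems[THEN times_differentiable_SucD]
    by (intro times_differentiable_add Suc.IH)
  with DERIV_mult[OF f'(1) g'(1)] show ?case
    by (rule times_differentiable_SucI)
qed simp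

lemma times_differentiable_const: "times_differentiable n (\<lambda>x. k)"
proof (induction n arbitrary: k)
  case (Suc n)
  show ?case by (rule times_differentiable_SucI[OF DERIV_const Suc.IH])
qed simp

lemma times_differentiable_affine:
  "times_differentiable n f \<Longrightarrow> times_differentiable n (\<lambda>x. f (k * x + l))"
proof (induction n arbitrary: f)
  case (Suc n)
  obtain f' where *: "\<And>x. (f has_real_derivative f' x) (at x)" "times_differentiable n f'"
    using Suc.prems by (rule times_differentiable_SucE) (rule that)
  have "times_differentiable n (\<lambda>x. f' (k * x + l) * k)"
    by (rule times_differentiable_mult[OF Suc.IH[OF *(2)] times_differentiable_const])
  moreover have "((\<lambda>x. f (k * x + l)) has_real_derivative f' (k * x + l) * k) (at x)" for x
    by (rule DERIV_chain2[OF *(1)]) (auto intro!: derivative_eq_intros)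
  ultimately show ?case
    by (intro times_differentiable_SucI[where f' = "\<lambda>x. f' (k * x + l) * k"])
qed simp

lemma higher_deriv_differentiable:
  "times_differentiable (Suc k) f \<Longrightarrow> ((deriv ^^ k) f) differentiable_on UNIV"
proof (induction k arbitrary: f)
  case 0
  then obtain f' where "\<And>x. (f has_real_derivative f' x) (at x)"
    by (rule times_differentiable_SucE) (rule that)
  then show ?case
    unfolding differentiable_on_def real_differentiable_def funpow_0 by blast
next
  case (Suc k)
  obtain f' where *: "\<And>x. (f has_real_derivative f' x) (at x)" "times_differentiable (Suc k) f'"
    using Suc.prems by (rule times_differentiable_SucE) (rule that)
  have "deriv f = f'"
    using * by (auto intro!: ext DERIV_imp_deriv)
  then show ?case
    using Suc.IH[OF *(2)] unfolding funpow_Suc_right o_apply by simp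
qed

text \<open>Closed under differentiation in the polynomial parameter.\<close>

definition flat :: "real poly \<Rightarrow> real \<Rightarrow> real" where
  "flat P x = (if 0 < x then poly P (1 / x) * exp (- (1 / x)) else 0)"

lemma poly_exp_tendsto_0: "((\<lambda>y :: real. poly P y * exp (- y)) \<longlongrightarrow> 0) at_top"
proof -
  have "((\<lambda>y. \<Sum>i\<le>degree P. coeff P i * (y ^ i / exp y)) \<longlongrightarrow> (\<Sum>i\<le>degree P. coeff P i * 0)) at_top"
    by (intro tendsto_intros tendsto_power_div_exp_0)
  then show ?thesis
    by (simp add: poly_altdef exp_minus sum_distrib_left sum_distrib_right divide_inverse mult_ac)
qed

text \<open>With \<open>y = 1 / x\<close> the product rule yields the factor \<open>y^2\<close>,
  encoded by \<open>[:0, 0, 1:]\<close>, times \<open>P - pderiv P\<close>. At 0 the right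
  difference quotient is \<open>y * P(y) * exp(- y)\<close> as \<open>y\<close> tends to
  infinity.\<close>

lemma flat_deriv:
  "(flat P has_real_derivative flat ([:0, 0, 1:] * (P - pderiv P)) x) (at x)"
proof -
  consider "0 < x" | "x < 0" | "x = 0" by linarith
  then show ?thesis
  proof cases
    case 1
    have inv: "((\<lambda>x. 1 / x) has_real_derivative - (1 / x ^ 2)) (at x)"
      using 1 by (auto intro!: derivative_eq_intros simp: power2_eq_square)
    have "((\<lambda>x. poly P (1 / x) * exp (- (1 / x))) has_real_derivative
        flat ([:0, 0, 1:] * (P - pderiv P)) x) (at x)"
      using DERIV_mult[OF DERIV_chain2[OF poly_DERIV inv] DERIV_chain2[OF DERIV_exp DERIV_minus[OF inv]], of P]
      using 1 by (simp add: flat_def power2_eq_square algebra_simps)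
    moreover have "\<forall>\<^sub>F y in nhds x. flat P y = poly P (1 / y) * exp (- (1 / y))"
      by (rule eventually_mono[OF eventually_nhds_in_open[OF open_greaterThan, of x 0]])
        (use 1 in \<open>auto simp: flat_def\<close>)
    ultimately show ?thesis
      by (subst DERIV_cong_ev[OF refl _ refl])
  next
    case 2
    have "\<forall>\<^sub>F y in nhds x. flat P y = 0"
      by (rule eventually_mono[OF eventually_nhds_in_open[OF open_lessThan, of x 0]])
        (use 2 in \<open>auto simp: flat_def\<close>)
    then show ?thesis
      using 2 by (subst DERIV_cong_ev[OF refl _ refl]) (auto simp: flat_def)
  next
    case 3
    have "((\<lambda>h. poly ([:0, 1:] * P) (inverse h) * exp (- inverse h)) \<longlongrightarrow> 0) (at_right 0)"
      by (rule filterlim_compose[OF poly_exp_tendsto_0 filterlim_inverse_at_top_right])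
    moreover have "\<forall>\<^sub>F h in at_right 0. poly ([:0, 1:] * P) (inverse h) * exp (- inverse h) = flat P h / h"
      by (auto simp: eventually_at_right_field flat_def field_simps intro!: exI[of _ 1])
    ultimately have "((\<lambda>h. flat P h / h) \<longlongrightarrow> 0) (at_right 0)"
      using tendsto_cong by fast
    moreover have "((\<lambda>h. flat P h / h) \<longlongrightarrow> 0) (at_left 0)"
      by (rule tendsto_eventually) (auto simp: eventually_at_left_field flat_def intro!: exI[of _ "-1"])
    ultimately have "((\<lambda>h. flat P h / h) \<longlongrightarrow> 0) (at 0)"
      by (simp add: filterlim_split_at)
    then show ?thesis
      using 3 by (simp add: DERIV_def flat_def)
  qed
qed

lemma flat_times_differentiable: "times_differentiable n (flat P)"
proof (induction n arbitrary: P)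
  case (Suc n)
  show ?case by (rule times_differentiable_SucI[OF flat_deriv Suc.IH])
qed simp

definition bump :: "real \<Rightarrow> real" where
  "bump t = flat 1 t * flat 1 (1 - t)"

lemma bump_nonneg: "0 \<le> bump t"
  by (simp add: bump_def flat_def)

lemma bump_pos: "0 < t \<Longrightarrow> t < 1 \<Longrightarrow> 0 < bump t"
  by (simp add: bump_def flat_def)

lemma bump_eq_0: "t \<le> 0 \<or> 1 \<le> t \<Longrightarrow> bump t = 0"
  by (auto simp: bump_def flat_def)

lemma bump_times_differentiable: "times_differentiable n bump"
proof -
  have "times_differentiable n (\<lambda>t. flat 1 (-1 * t + 1))"
    by (rule times_differentiable_affine[OF flat_times_differentiable])
  with flat_times_differentiable have "times_differentiable n (\<lambda>t. flat 1 t * flat 1 (-1 * t + 1))"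
    by (rule times_differentiable_mult)
  then show ?thesis by (simp add: bump_def[abs_def])
qed

lemma continuous_on_bump [continuous_intros]:
  assumes "continuous_on S g"
  shows "continuous_on S (\<lambda>x. bump (g x))"
proof -
  have "continuous_on UNIV bump"
    using bump_times_differentiable[of "Suc 0"] unfolding times_differentiable.simps
    by (blast intro: DERIV_continuous_on)
  then show ?thesis
    using assms by (rule continuous_on_compose2) auto
qed

text \<open>Two translates of one bump have the same integral, so their difference has an
  antiderivative that vanishes outside a compact interval. It is built from an antiderivative
  \<open>R\<close> of \<open>bump\<close>, which is constant before 0 and after 1.\<close>

lemma test_function_bump_difference:
  assumes "a < x" "x < y" "0 < \<epsilon>" "y + \<epsilon> < b"
  obtains \<phi> where "test_function {a<..<b} \<phi>"
    "\<And>t. (\<phi> has_real_derivative bump ((t - x) / \<epsilon>) - bump ((t - y) / \<epsilon>)) (at t)"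
    "\<And>t. t \<le> x \<or> y + \<epsilon> \<le> t \<Longrightarrow> \<phi> t = 0"
proof -
  have "continuous_on UNIV bump"
    using continuous_on_bump[OF continuous_on_id] .
  then have "isCont bump t" for t
    by (simp add: continuous_on_eq_continuous_at)
  then have "\<exists>R. \<forall>t. (R has_vector_derivative bump t) (at t)"
    using einterval_antiderivative[of "-\<infinity>" "\<infinity>" bump] by simp
  then obtain R where "\<forall>t. (R has_vector_derivative bump t) (at t)" ..
  then have R: "(R has_real_derivative bump t) (at t)" for t
    by (simp add: has_real_derivative_iff_has_vector_derivative)
  have R0: "R t = R 0" if "t \<le> 0" for t
  proof (cases "t = 0")
    case False
    with that have "t < 0" by linarith
    from MVT2[OF this R] obtain s where s: "t < s \<and> s < 0 \<and> R 0 - R t = (0 - t) * bump s" ..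
    moreover have "bump s = 0" using s by (intro bump_eq_0) simp
    ultimately show ?thesis by simp
  qed simp
  have R1: "R t = R 1" if "1 \<le> t" for t
  proof (cases "t = 1")
    case False
    with that have "1 < t" by linarith
    from MVT2[OF this R] obtain s where s: "1 < s \<and> s < t \<and> R t - R 1 = (t - 1) * bump s" ..
    moreover have "bump s = 0" using s by (intro bump_eq_0) simp
    ultimately show ?thesis by simp
  qed simp
  define \<phi> where "\<phi> t = \<epsilon> * (R ((t - x) / \<epsilon>) - R ((t - y) / \<epsilon>))" for t
  have zero: "\<phi> t = 0" if "t \<le> x \<or> y + \<epsilon> \<le> t" for t
    using that
  proof
    assume "t \<le> x"
    then have "(t - x) / \<epsilon> \<le> 0" "(t - y) / \<epsilon> \<le> 0"
      using assms by (auto simp: divide_le_0_iff)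
    then have "R ((t - x) / \<epsilon>) = R 0" "R ((t - y) / \<epsilon>) = R 0"
      by (auto intro: R0)
    then show ?thesis by (simp add: \<phi>_def)
  next
    assume "y + \<epsilon> \<le> t"
    then have "1 \<le> (t - x) / \<epsilon>" "1 \<le> (t - y) / \<epsilon>"
      using assms by (auto simp: le_divide_eq)
    then have "R ((t - x) / \<epsilon>) = R 1" "R ((t - y) / \<epsilon>) = R 1"
      by (auto intro: R1)
    then show ?thesis by (simp add: \<phi>_def)
  qed
  have deriv: "(\<phi> has_real_derivative bump ((t - x) / \<epsilon>) - bump ((t - y) / \<epsilon>)) (at t)" for t
  proof -
    have *: "((\<lambda>t. R ((t - s) / \<epsilon>)) has_real_derivative bump ((t - s) / \<epsilon>) * (1 / \<epsilon>)) (at t)" for s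
      by (rule DERIV_chain2[OF R]) (use assms in \<open>auto intro!: derivative_eq_intros\<close>)
    show ?thesis
      using DERIV_cmult[OF DERIV_diff[OF *[of x] *[of y]], of \<epsilon>] assms
      unfolding \<phi>_def by (simp add: right_diff_distrib)
  qed
  have R': "times_differentiable n R" for n
    by (rule times_differentiable_SucD[OF times_differentiable_SucI[OF R bump_times_differentiable]])
  have smooth: "times_differentiable n \<phi>" for n
  proof -
    have shift: "times_differentiable n (\<lambda>t. R (1 / \<epsilon> * t + - s / \<epsilon>))" for s
      by (rule times_differentiable_affine[OF R'])
    have "times_differentiable n (\<lambda>t. R (1 / \<epsilon> * t + - x / \<epsilon>) + (- 1) * R (1 / \<epsilon> * t + - y / \<epsilon>))"
      by (rule times_differentiable_add[OF shift times_differentiable_mult[OF times_differentiable_const shift]])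
    then have "times_differentiable n (\<lambda>t. \<epsilon> * (R (1 / \<epsilon> * t + - x / \<epsilon>) + (- 1) * R (1 / \<epsilon> * t + - y / \<epsilon>)))"
      by (rule times_differentiable_mult[OF times_differentiable_const])
    moreover have "(\<lambda>t. \<epsilon> * (R (1 / \<epsilon> * t + - x / \<epsilon>) + (- 1) * R (1 / \<epsilon> * t + - y / \<epsilon>))) = \<phi>"
      by (simp add: \<phi>_def fun_eq_iff diff_divide_distrib)
    ultimately show ?thesis by simp
  qed
  have supp: "closure {t. \<phi> t \<noteq> 0} \<subseteq> {x..y + \<epsilon>}"
  proof (rule closure_minimal)
    show "{t. \<phi> t \<noteq> 0} \<subseteq> {x..y + \<epsilon>}"
    proof
      fix t assume "t \<in> {t. \<phi> t \<noteq> 0}"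
      then show "t \<in> {x..y + \<epsilon>}" using zero[of t] by (cases "t \<le> x"; cases "y + \<epsilon> \<le> t") auto
    qed
  qed simp
  have "test_function {a<..<b} \<phi>"
    unfolding test_function_def
  proof (intro conjI allI)
    show "((deriv ^^ k) \<phi>) differentiable_on UNIV" for k
      by (rule higher_deriv_differentiable[OF smooth])
    show "compact (closure {t. \<phi> t \<noteq> 0})"
      using supp bounded_subset[OF bounded_closed_interval] by (simp add: compact_eq_bounded_closed)
    show "closure {t. \<phi> t \<noteq> 0} \<subseteq> {a<..<b}"
      using supp assms by force
  qed
  then show thesis
    using deriv zero by (rule that)
qed

text \<open>With an antiderivative \<open>\<zeta>\<close> of \<open>- g\<close>, integration by
  parts shows that \<open>h = Z - \<zeta>\<close> is orthogonal to \<open>deriv \<phi>\<close>. For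
  a difference of two bumps this says that the averages of \<open>h\<close> just to the right of
  \<open>x\<close> and of \<open>y\<close> coincide, and continuity makes
  \<open>h x = h y\<close>.\<close>

lemma du_Bois_Reymond:
  fixes Z g :: "real \<Rightarrow> real"
  assumes cZ: "continuous_on {a<..<b} Z"
    and g: "\<And>c d. a < c \<Longrightarrow> d < b \<Longrightarrow> g absolutely_integrable_on {c..d}"
    and weak: "\<And>\<phi>. test_function {a<..<b} \<phi> \<Longrightarrow>
      (LINT x:{a<..<b}|lebesgue. Z x * deriv \<phi> x) = (LINT x:{a<..<b}|lebesgue. g x * \<phi> x)"
    and xy: "a < x" "x \<le> y" "y < b"
  shows "(g has_integral (Z x - Z y)) {x..y}"
proof (cases "x = y")
  case False
  then have "x < y" using xy by simp
  \<comment> \<open>The second bump lives on the interval from \<open>y\<close> to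
    \<open>y + \<epsilon>\<close>; \<open>d\<close> leaves room for it.\<close>
  define d where "d = (y + b) / 2"
  have d: "y < d" "d < b" using xy by (auto simp: d_def)
  have gd: "g absolutely_integrable_on {x..d}"
    using g xy d by simp
  then have gi: "g integrable_on {x..d}"
    using set_lebesgue_integral_eq_integral(1) by blast
  define \<zeta> where "\<zeta> t = - integral {x..t} g" for t
  have \<zeta>: "(g has_integral (\<zeta> s - \<zeta> t)) {s..t}" if "x \<le> s" "s \<le> t" "t \<le> d" for s t
  proof -
    have "integral {x..s} g + integral {s..t} g = integral {x..t} g"
      using that gi
      by (intro Henstock_Kurzweil_Integration.integral_combine) (auto intro: integrable_on_subinterval)
    moreover have "g integrable_on {s..t}"
      using that gi by (auto intro: integrable_on_subinterval)
    ultimately show ?thesis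
      by (simp add: has_integral_iff \<zeta>_def)
  qed
  define h where "h t = Z t - \<zeta> t" for t
  have cZ': "continuous_on {x..d} Z"
    using xy d by (intro continuous_on_subset[OF cZ]) auto
  have c\<zeta>: "continuous_on {x..d} \<zeta>"
    using \<zeta> by (rule continuous_on_indefinite)
  have ch: "continuous_on {x..d} h"
    unfolding h_def by (intro continuous_intros cZ' c\<zeta>)
  have "h x = h y"
  proof (rule ccontr)
    assume "h x \<noteq> h y"
    \<comment> \<open>Each average will differ from the point value by at most
      \<open>\<eta>\<close>, so equal averages force a distance of at most
      \<open>2 * \<eta>\<close>, against the factor 3.\<close>
    define \<eta> where "\<eta> = \<bar>h x - h y\<bar> / 3"
    have \<eta>: "0 < \<eta>" using \<open>h x \<noteq> h y\<close> by (simp add: \<eta>_def)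
    obtain \<delta> where \<delta>: "0 < \<delta>" "\<And>s t. s \<in> {x..d} \<Longrightarrow> t \<in> {x..d} \<Longrightarrow> \<bar>t - s\<bar> < \<delta> \<Longrightarrow> \<bar>h t - h s\<bar> < \<eta>"
      using compact_uniformly_continuous[OF ch compact_Icc] \<eta>
      unfolding uniformly_continuous_on_def dist_real_def by meson
    define \<epsilon> where "\<epsilon> = min \<delta> (d - y) / 2"
    have \<epsilon>: "0 < \<epsilon>" "\<epsilon> < \<delta>" "y + \<epsilon> < d"
      using \<delta>(1) d by (auto simp: \<epsilon>_def min_def field_simps)
    obtain \<phi> where \<phi>: "test_function {a<..<b} \<phi>"
      "\<And>t. (\<phi> has_real_derivative bump ((t - x) / \<epsilon>) - bump ((t - y) / \<epsilon>)) (at t)"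
      "\<And>t. t \<le> x \<or> y + \<epsilon> \<le> t \<Longrightarrow> \<phi> t = 0"
      by (rule test_function_bump_difference[OF xy(1) \<open>x < y\<close> \<epsilon>(1) order.strict_trans[OF \<epsilon>(3) d(2)]]) blast
    define \<phi>' where "\<phi>' t = bump ((t - x) / \<epsilon>) - bump ((t - y) / \<epsilon>)" for t
    have \<phi>': "(\<phi> has_real_derivative \<phi>' t) (at t)" "deriv \<phi> t = \<phi>' t" for t
      using \<phi>(2)[of t] by (auto simp: \<phi>'_def DERIV_imp_deriv)
    have c\<phi>': "continuous_on S \<phi>'" for S
      unfolding \<phi>'_def using \<epsilon> by (intro continuous_intros) auto
    have c\<phi>: "continuous_on S \<phi>" for S
      by (rule DERIV_continuous_on[OF has_field_derivative_at_within[OF \<phi>'(1)]])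
    have \<phi>'0: "\<phi>' t = 0" if "t \<notin> {x..d}" for t
    proof -
      have "(t - x) / \<epsilon> \<le> 0 \<and> (t - y) / \<epsilon> \<le> 0 \<or> 1 \<le> (t - x) / \<epsilon> \<and> 1 \<le> (t - y) / \<epsilon>"
        using that \<epsilon> \<open>x < y\<close> by (auto simp: divide_le_0_iff le_divide_eq)
      then show ?thesis by (auto simp: \<phi>'_def bump_eq_0)
    qed
    have sub: "{x..d} \<subseteq> {a<..<b}" using xy d by auto
    have "integral {x..d} (\<lambda>t. Z t * \<phi>' t) = integral {x..d} (\<lambda>t. g t * \<phi> t)"
    proof -
      have "(\<lambda>t. Z t * \<phi>' t) absolutely_integrable_on {x..d}"
        by (intro absolutely_integrable_continuous_real continuous_intros cZ' c\<phi>')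
      then have "(LINT t:{a<..<b}|lebesgue. Z t * \<phi>' t) = integral {x..d} (\<lambda>t. Z t * \<phi>' t)"
        using sub \<phi>'0 by (intro zero_extension_set_integral(2)) auto
      moreover have "(LINT t:{a<..<b}|lebesgue. g t * \<phi> t) = integral {x..d} (\<lambda>t. g t * \<phi> t)"
        using sub \<phi>(3) \<epsilon> by (intro zero_extension_set_integral(2) absolutely_integrable_mult_continuous gd c\<phi>) auto
      ultimately show ?thesis
        using weak[OF \<phi>(1)] by (simp add: \<phi>'(2))
    qed
    moreover have "((\<lambda>t. \<zeta> t * \<phi>' t - g t * \<phi> t) has_integral (\<zeta> d * \<phi> d - \<zeta> x * \<phi> x)) {x..d}"
      using \<phi>'(1) xy d
      by (intro integration_by_parts_indefinite \<zeta> gd c\<phi>') (auto intro: has_field_derivative_at_within)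
    then have "((\<lambda>t. \<zeta> t * \<phi>' t - g t * \<phi> t) has_integral 0) {x..d}"
      using \<phi>(3)[of d] \<phi>(3)[of x] \<epsilon> by simp
    then have "integral {x..d} (\<lambda>t. \<zeta> t * \<phi>' t) = integral {x..d} (\<lambda>t. g t * \<phi> t)"
    proof -
      assume "((\<lambda>t. \<zeta> t * \<phi>' t - g t * \<phi> t) has_integral 0) {x..d}"
      then have "integral {x..d} (\<lambda>t. \<zeta> t * \<phi>' t - g t * \<phi> t) = 0"
        by (rule integral_unique)
      moreover have "(\<lambda>t. \<zeta> t * \<phi>' t) integrable_on {x..d}"
        by (intro integrable_continuous_real continuous_intros c\<zeta> c\<phi>')
      moreover have "(\<lambda>t. g t * \<phi> t) integrable_on {x..d}"
        by (intro set_lebesgue_integral_eq_integral(1) absolutely_integrable_mult_continuous gd c\<phi>)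
      ultimately show ?thesis
        by (simp add: Henstock_Kurzweil_Integration.integral_diff)
    qed
    moreover have "integral {x..d} (\<lambda>t. h t * \<phi>' t)
        = integral {x..d} (\<lambda>t. Z t * \<phi>' t) - integral {x..d} (\<lambda>t. \<zeta> t * \<phi>' t)"
      unfolding h_def left_diff_distrib
      by (intro Henstock_Kurzweil_Integration.integral_diff integrable_continuous_real
          continuous_intros cZ' c\<zeta> c\<phi>')
    ultimately have h0: "integral {x..d} (\<lambda>t. h t * \<phi>' t) = 0" by simp
    \<comment> \<open>The mass of the bump at \<open>s\<close>. The masses at \<open>x\<close> and
      \<open>y\<close> agree because \<open>\<phi>'\<close> has integral 0, and this common positive
      factor cancels at the end, so that the bump needs no normalisation.\<close>
    define I where "I s = integral {x..d} (\<lambda>t. bump ((t - s) / \<epsilon>))" for s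
    have cb: "continuous_on S (\<lambda>t. bump ((t - s) / \<epsilon>))" for s S
      using \<epsilon> by (intro continuous_intros) auto
    have bi: "(\<lambda>t. bump ((t - s) / \<epsilon>)) integrable_on {x..d}" for s
      by (intro integrable_continuous_real cb)
    have hbi: "(\<lambda>t. h t * bump ((t - s) / \<epsilon>)) integrable_on {x..d}" for s
      by (intro integrable_continuous_real continuous_intros ch cb)
    have "(\<phi>' has_integral (\<phi> d - \<phi> x)) {x..d}"
      using \<phi>'(1) xy d
      by (intro fundamental_theorem_of_calculus)
        (auto simp: has_real_derivative_iff_has_vector_derivative[symmetric] intro: has_field_derivative_at_within)
    then have "integral {x..d} \<phi>' = 0"
      using \<phi>(3)[of d] \<phi>(3)[of x] \<epsilon> by (simp add: integral_unique)
    then have Ieq: "I x = I y"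
      unfolding \<phi>'_def I_def by (simp add: Henstock_Kurzweil_Integration.integral_diff bi)
    have Ipos: "0 < I x"
    proof -
      have "0 \<le> I x"
        unfolding I_def by (intro Henstock_Kurzweil_Integration.integral_nonneg bi) (simp add: bump_nonneg)
      moreover have "I x \<noteq> 0"
      proof
        assume "I x = 0"
        then have "\<forall>t\<in>{x..d}. bump ((t - x) / \<epsilon>) = 0"
          unfolding I_def using integral_eq_0_iff[OF cb, of x d x] xy d bump_nonneg by simp
        then have "bump ((x + \<epsilon> / 2 - x) / \<epsilon>) = 0"
          by (rule bspec) (use \<epsilon> \<open>x < y\<close> in auto)
        then show False
          using bump_pos[of "1 / 2"] \<epsilon> by simp
      qed
      ultimately show ?thesis by simp
    qed
    have near: "\<bar>integral {x..d} (\<lambda>t. h t * bump ((t - s) / \<epsilon>)) - h s * I s\<bar> \<le> \<eta> * I s"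
      if s: "s \<in> {x..y}" for s
    proof -
      have "integral {x..d} (\<lambda>t. h t * bump ((t - s) / \<epsilon>)) - h s * I s
          = integral {x..d} (\<lambda>t. h t * bump ((t - s) / \<epsilon>) - h s * bump ((t - s) / \<epsilon>))"
        unfolding I_def
        by (subst Henstock_Kurzweil_Integration.integral_diff) (auto intro: hbi bi integrable_on_mult_right)
      also have "norm \<dots> \<le> integral {x..d} (\<lambda>t. \<eta> * bump ((t - s) / \<epsilon>))"
      proof (rule Henstock_Kurzweil_Integration.integral_norm_bound_integral)
        show "(\<lambda>t. h t * bump ((t - s) / \<epsilon>) - h s * bump ((t - s) / \<epsilon>)) integrable_on {x..d}"
          by (intro Henstock_Kurzweil_Integration.integrable_diff hbi bi integrable_on_mult_right)
        show "(\<lambda>t. \<eta> * bump ((t - s) / \<epsilon>)) integrable_on {x..d}"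
          by (intro bi integrable_on_mult_right)
        fix t assume t: "t \<in> {x..d}"
        show "norm (h t * bump ((t - s) / \<epsilon>) - h s * bump ((t - s) / \<epsilon>)) \<le> \<eta> * bump ((t - s) / \<epsilon>)"
        proof (cases "s \<le> t \<and> t \<le> s + \<epsilon>")
          case True
          then have "\<bar>h t - h s\<bar> \<le> \<eta>"
            using t s d \<epsilon> by (intro less_imp_le \<delta>(2)) auto
          then have "\<bar>h t - h s\<bar> * bump ((t - s) / \<epsilon>) \<le> \<eta> * bump ((t - s) / \<epsilon>)"
            by (rule mult_right_mono[OF _ bump_nonneg])
          then show ?thesis
            using bump_nonneg[of "(t - s) / \<epsilon>"] by (simp add: left_diff_distrib[symmetric] abs_mult)
        next
          case False
          then have "(t - s) / \<epsilon> \<le> 0 \<or> 1 \<le> (t - s) / \<epsilon>"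
            using \<epsilon> by (auto simp: divide_le_0_iff le_divide_eq)
          then show ?thesis by (simp add: bump_eq_0)
        qed
      qed
      finally show ?thesis by (simp add: I_def)
    qed
    have "integral {x..d} (\<lambda>t. h t * bump ((t - x) / \<epsilon>)) = integral {x..d} (\<lambda>t. h t * bump ((t - y) / \<epsilon>))"
      using h0 unfolding \<phi>'_def right_diff_distrib
      by (simp add: Henstock_Kurzweil_Integration.integral_diff hbi)
    then have "\<bar>h x * I x - h y * I x\<bar> \<le> 2 * (\<eta> * I x)"
      using near[of x] near[of y] xy Ieq by auto
    then have "\<bar>h x - h y\<bar> * I x \<le> (2 * \<eta>) * I x"
      using Ipos by (simp add: left_diff_distrib[symmetric] abs_mult)
    then have "\<bar>h x - h y\<bar> \<le> 2 * \<eta>"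
      using Ipos by simp
    then show False using \<eta> by (simp add: \<eta>_def)
  qed
  then have "Z x - Z y = \<zeta> x - \<zeta> y" by (simp add: h_def)
  then show ?thesis using \<zeta>[of x y] xy d by simp
qed (simp add: has_integral_refl)

section \<open>Solutions between a sub- and a supersolution\<close>

text \<open>\<open>gv\<close> and \<open>G\<close> stand for \<open>- zv'\<close> and
  \<open>- zw'\<close>. The condition \<open>super\<close> uses the majorant of \<open>f\<close>
  instead of \<open>m x * f (w x)\<close>, because it has to control \<open>m x * f s\<close> for
  all \<open>s\<close> above \<open>w x\<close>.\<close>

locale ordered_sub_super =
  fixes a b r \<gamma> C :: real and m f v zv gv w zw G :: "real \<Rightarrow> real"
  assumes ab: "a < b" and r: "0 < r" and \<gamma>: "0 < \<gamma>"
    and m: "m absolutely_integrable_on {a..b}"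
    and cf: "continuous_on {0<..} f"
    and f: "\<And>\<xi>. 0 < \<xi> \<Longrightarrow> 0 < f \<xi> \<and> f \<xi> \<le> C * \<xi> powr (- \<gamma>)"
    and cv: "continuous_on {a..b} v" and va: "v a = 0" and vb: "v b = 0"
    and v0: "\<And>x. a < x \<Longrightarrow> x < b \<Longrightarrow> 0 < v x"
    and dv: "\<And>x. a < x \<Longrightarrow> x < b \<Longrightarrow> (v has_real_derivative spow r (zv x)) (at x)"
    and zv: "\<And>x y. a < x \<Longrightarrow> x \<le> y \<Longrightarrow> y < b \<Longrightarrow> (gv has_integral (zv x - zv y)) {x..y}"
    and sub: "\<And>x. a < x \<Longrightarrow> x < b \<Longrightarrow> gv x \<le> m x * f (v x)"
    and cw: "continuous_on {a..b} w" and wa: "w a = 0" and wb: "w b = 0"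
    and w0: "\<And>x. a < x \<Longrightarrow> x < b \<Longrightarrow> 0 < w x"
    and dw: "\<And>x. a < x \<Longrightarrow> x < b \<Longrightarrow> (w has_real_derivative spow r (zw x)) (at x)"
    and zw: "\<And>x y. a < x \<Longrightarrow> x \<le> y \<Longrightarrow> y < b \<Longrightarrow> (G has_integral (zw x - zw y)) {x..y}"
    and super: "\<And>x. a < x \<Longrightarrow> x < b \<Longrightarrow> C * max (m x) 0 * w x powr (- \<gamma>) \<le> G x"
begin

lemma C0: "0 < C"
  using f[of 1] by simp

text \<open>\<open>f\<close> is positive, so replacing \<open>m\<close> by its positive part only
  increases the product; the majorant \<open>C * s powr (- \<gamma>)\<close> is nonincreasing and
  hence at most its value at \<open>w x\<close>.\<close>

lemma above_supersolution:
  assumes "a < x" "x < b" "w x < s"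
  shows "m x * f s \<le> G x"
proof -
  have w: "0 < w x" using w0 assms by simp
  have "m x * f s \<le> max (m x) 0 * f s"
    using f[of s] w assms by (intro mult_right_mono) auto
  also have "\<dots> \<le> max (m x) 0 * (C * s powr (- \<gamma>))"
    using f[of s] w assms by (intro mult_left_mono) auto
  also have "\<dots> = C * max (m x) 0 * s powr (- \<gamma>)" by simp
  also have "\<dots> \<le> C * max (m x) 0 * w x powr (- \<gamma>)"
    using C0 w assms \<gamma> by (intro mult_left_mono powr_mono2') auto
  also have "\<dots> \<le> G x" using super assms by simp
  finally show ?thesis .
qed

lemma sub_le_super:
  assumes "x \<in> {a..b}"
  shows "v x \<le> w x"
proof (rule flux_comparison[OF r less_imp_le[OF ab] cv cw dv dw _ _ _ assms])
  show "zv x - zv y \<le> zw x - zw y"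
    if xy: "a < x" "x \<le> y" "y < b" and above: "\<And>t. t \<in> {x..y} \<Longrightarrow> w t < v t" for x y
  proof (rule has_integral_le[OF zv[OF xy] zw[OF xy]])
    fix t assume t: "t \<in> {x..y}"
    then have "gv t \<le> m t * f (v t)" using sub xy by simp
    also have "\<dots> \<le> G t" using above[OF t] t xy by (intro above_supersolution) auto
    finally show "gv t \<le> G t" .
  qed
qed (simp_all add: va vb wa wb)

text \<open>On a compact subinterval \<open>v\<close> has a positive minimum, and the upper bound on
  \<open>f\<close> is largest there. This removes the singularity from the truncated
  problem.\<close>

lemma f_bounded_above_subsolution:
  assumes "a < c" "c < d" "d < b"
  obtains K where "\<And>x s. x \<in> {c..d} \<Longrightarrow> v x \<le> s \<Longrightarrow> \<bar>f s\<bar> \<le> K"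
proof -
  have "continuous_on {c..d} v"
    using assms by (intro continuous_on_subset[OF cv]) auto
  from continuous_attains_inf[OF compact_Icc _ this] obtain t
    where t: "t \<in> {c..d}" "\<And>x. x \<in> {c..d} \<Longrightarrow> v t \<le> v x"
    using assms by auto
  have vt: "0 < v t" using t v0 assms by auto
  show thesis
  proof (rule that)
    fix x s assume "x \<in> {c..d}" "v x \<le> s"
    then have "v t \<le> s" using t by force
    have "\<bar>f s\<bar> \<le> C * s powr (- \<gamma>)"
      using f[of s] vt \<open>v t \<le> s\<close> by simp
    also have "\<dots> \<le> C * v t powr (- \<gamma>)"
      using C0 vt \<gamma> \<open>v t \<le> s\<close> by (intro mult_left_mono powr_mono2') auto
    finally show "\<bar>f s\<bar> \<le> C * v t powr (- \<gamma>)" .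
  qed
qed

text \<open>The boundary data are the values of \<open>v\<close>, which lie below those of
  \<open>w\<close>. Cutting off at \<open>v\<close> bounds the right-hand side; in the comparison
  with \<open>w\<close> the cut-off is inactive, since there \<open>u\<close> exceeds
  \<open>w\<close> and therefore \<open>v\<close>.\<close>

lemma interior_solution:
  assumes acd: "a < c" "c < d" "d < b"
  obtains u z where
    "\<And>x. x \<in> {c..d} \<Longrightarrow> (u has_real_derivative spow r (z x)) (at x within {c..d})"
    "\<And>x y. c \<le> x \<Longrightarrow> x \<le> y \<Longrightarrow> y \<le> d \<Longrightarrow> ((\<lambda>s. m s * f (u s)) has_integral (z x - z y)) {x..y}"
    "\<And>x. x \<in> {c..d} \<Longrightarrow> v x \<le> u x \<and> u x \<le> w x"
proof -
  obtain K where K: "\<And>x s. x \<in> {c..d} \<Longrightarrow> v x \<le> s \<Longrightarrow> \<bar>f s\<bar> \<le> K"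
    using f_bounded_above_subsolution[OF acd] by metis
  have cvd: "continuous_on {c..d} v"
    using acd by (intro continuous_on_subset[OF cv]) auto
  have cwd: "continuous_on {c..d} w"
    using acd by (intro continuous_on_subset[OF cw]) auto
  have vd0: "0 < v x" if "x \<in> {c..d}" for x
    using v0 that acd by auto
  interpret bounded_rhs c d r K m "\<lambda>x s. f (max (v x) s)"
  proof
    show "m absolutely_integrable_on {c..d}"
      using acd by (intro absolutely_integrable_on_subinterval[OF m]) auto
    have "continuous_on ({c..d} \<times> UNIV) (\<lambda>p :: real \<times> real. v (fst p))"
      by (rule continuous_on_compose2[OF cvd]) (auto intro!: continuous_intros)
    then have "continuous_on ({c..d} \<times> UNIV) (\<lambda>p. f (max (v (fst p)) (snd p)))"
      by (intro continuous_on_compose2[OF cf] continuous_intros) (auto simp: less_max_iff_disj vd0)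
    then show "continuous_on ({c..d} \<times> UNIV) (\<lambda>(x, s). f (max (v x) s))"
      by (simp add: case_prod_unfold)
  qed (use acd r K in auto)
  obtain u z where
    u: "\<And>x. x \<in> {c..d} \<Longrightarrow> (u has_real_derivative spow r (z x)) (at x within {c..d})" and
    z: "\<And>x y. c \<le> x \<Longrightarrow> x \<le> y \<Longrightarrow> y \<le> d \<Longrightarrow>
          ((\<lambda>s. m s * f (max (v s) (u s))) has_integral (z x - z y)) {x..y}" and
    bc: "u c = v c" "u d = v d"
    by (rule boundary_value_solution[where A="v c" and B="v d"]) (rule that)
  have cu: "continuous_on {c..d} u"
    by (rule DERIV_continuous_on[OF u])
  have du: "(u has_real_derivative spow r (z x)) (at x)" if "c < x" "x < d" for x
    using u[of x] that by (simp add: at_within_Icc_at)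
  have vu: "v x \<le> u x" if "x \<in> {c..d}" for x
  proof (rule flux_comparison[OF r less_imp_le[OF acd(2)] cvd cu dv du _ _ _ that])
    show "zv x - zv y \<le> z x - z y"
      if xy: "c < x" "x \<le> y" "y < d" and above: "\<And>t. t \<in> {x..y} \<Longrightarrow> u t < v t" for x y
    proof (rule has_integral_le[OF zv z])
      fix t assume t: "t \<in> {x..y}"
      then have "max (v t) (u t) = v t" using above[OF t] by simp
      then show "gv t \<le> m t * f (max (v t) (u t))"
        using sub[of t] t xy acd by simp
    qed (use xy acd in auto)
  qed (use bc acd in auto)
  have uw: "u x \<le> w x" if "x \<in> {c..d}" for x
  proof (rule flux_comparison[OF r less_imp_le[OF acd(2)] cu cwd du dw _ _ _ that])
    show "z x - z y \<le> zw x - zw y"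
      if xy: "c < x" "x \<le> y" "y < d" and above: "\<And>t. t \<in> {x..y} \<Longrightarrow> w t < u t" for x y
    proof (rule has_integral_le[OF z zw])
      fix t assume t: "t \<in> {x..y}"
      then have "v t \<le> w t" using xy acd by (intro sub_le_super) auto
      then have "max (v t) (u t) = u t" using above[OF t] by simp
      then show "m t * f (max (v t) (u t)) \<le> G t"
        using above_supersolution[of t "u t"] above[OF t] t xy acd by simp
    qed (use xy acd in auto)
    show "u c \<le> w c" "u d \<le> w d"
      using bc sub_le_super[of c] sub_le_super[of d] acd by auto
  qed (use acd in auto)
  show thesis
  proof (rule that[OF u])
    show "((\<lambda>s. m s * f (u s)) has_integral (z x - z y)) {x..y}" if "c \<le> x" "x \<le> y" "y \<le> d" for x y
      by (rule has_integral_eq[OF _ z[OF that]]) (use vu that in \<open>auto simp: max_absorb2\<close>)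
    show "v x \<le> u x \<and> u x \<le> w x" if "x \<in> {c..d}" for x
      using vu[OF that] uw[OF that] by simp
  qed
qed

theorem solution_between:
  obtains u z where
    "continuous_on {a..b} u" "u a = 0" "u b = 0" "\<And>x. a < x \<Longrightarrow> x < b \<Longrightarrow> 0 < u x"
    "\<And>x. a < x \<Longrightarrow> x < b \<Longrightarrow> (u has_real_derivative spow r (z x)) (at x)"
    "\<And>x y. a < x \<Longrightarrow> x \<le> y \<Longrightarrow> y < b \<Longrightarrow> ((\<lambda>s. m s * f (u s)) has_integral (z x - z y)) {x..y}"
proof -

  \<comment> \<open>Solutions on an exhausting sequence of subintervals\<close>
  define e where "e n = (b - a) / real (n + 3)" for n
  have e: "0 < e n" "a + e n < b - e n" for n
  proof -
    \<comment> \<open>The shift by 3 keeps twice the margin \<open>e n\<close> strictly below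
      \<open>b - a\<close>, so already the first subinterval is nondegenerate.\<close>
    have "e n < (b - a) / 2"
      unfolding e_def using ab by (intro divide_strict_left_mono) auto
    then show "a + e n < b - e n"
      by (simp add: field_simps)
  qed (use ab in \<open>simp add: e_def\<close>)
  have e0: "e \<longlonglongrightarrow> 0"
    unfolding e_def using LIMSEQ_ignore_initial_segment[OF lim_const_over_n[of "b - a"], of 3] by simp
  define P where "P n u z \<longleftrightarrow>
      (\<forall>x\<in>{a + e n..b - e n}. (u has_real_derivative spow r (z x)) (at x within {a + e n..b - e n})) \<and>
      (\<forall>x y. a + e n \<le> x \<longrightarrow> x \<le> y \<longrightarrow> y \<le> b - e n \<longrightarrow> ((\<lambda>s. m s * f (u s)) has_integral (z x - z y)) {x..y}) \<and>
      (\<forall>x\<in>{a + e n..b - e n}. v x \<le> u x \<and> u x \<le> w x)" for n u z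
  have "\<exists>u z. P n u z" for n
  proof -
    from e[of n] have "a < a + e n" "a + e n < b - e n" "b - e n < b" by simp_all
    then obtain u z where
      "\<And>x. x \<in> {a + e n..b - e n} \<Longrightarrow> (u has_real_derivative spow r (z x)) (at x within {a + e n..b - e n})"
      "\<And>x y. a + e n \<le> x \<Longrightarrow> x \<le> y \<Longrightarrow> y \<le> b - e n \<Longrightarrow> ((\<lambda>s. m s * f (u s)) has_integral (z x - z y)) {x..y}"
      "\<And>x. x \<in> {a + e n..b - e n} \<Longrightarrow> v x \<le> u x \<and> u x \<le> w x"
      by (rule interior_solution) (rule that)
    then have "P n u z"
      unfolding P_def by blast
    then show ?thesis by blast
  qed
  then obtain u0 z where P: "\<And>n. P n (u0 n) (z n)"
    by metis
  have u0: "(u0 n has_real_derivative spow r (z n x)) (at x within {a + e n..b - e n})"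
    if "x \<in> {a + e n..b - e n}" for n x
    using P[of n] that unfolding P_def by blast
  have z: "((\<lambda>s. m s * f (u0 n s)) has_integral (z n x - z n y)) {x..y}"
    if "a + e n \<le> x" "x \<le> y" "y \<le> b - e n" for n x y
    using P[of n] that unfolding P_def by blast
  have between: "v x \<le> u0 n x \<and> u0 n x \<le> w x" if "x \<in> {a + e n..b - e n}" for n x
    using P[of n] that unfolding P_def by blast
  \<comment> \<open>Filling up with \<open>v\<close> keeps the bounds by \<open>v\<close> and
    \<open>w\<close> valid on all of \<open>{a..b}\<close> and for every \<open>n\<close>.\<close>
  define U where "U n x = (if x \<in> {a + e n..b - e n} then u0 n x else v x)" for n x
  have U: "v x \<le> U n x" "U n x \<le> w x" if "x \<in> {a..b}" for n x
    using between[of x n] sub_le_super[OF that] by (auto simp: U_def)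
  have exhaust: "\<exists>N. \<forall>n\<ge>N. a + e n < c \<and> d < b - e n" if "a < c" "d < b" for c d
  proof -
    have "\<forall>\<^sub>F n in sequentially. e n < min (c - a) (b - d)"
      using e0 that by (intro order_tendstoD) auto
    then show ?thesis
      by (auto simp: eventually_sequentially field_simps less_diff_eq)
  qed

  \<comment> \<open>Bounds on compact subintervals, uniform for large n\<close>
  obtain W where W: "\<And>x. x \<in> {a..b} \<Longrightarrow> w x \<le> W"
    using continuous_attains_sup[OF compact_Icc _ cw] ab by fastforce
  have local_bound: "\<exists>J N. \<forall>n\<ge>N. a + e n < c \<and> d < b - e n \<and> (\<forall>x\<in>{c..d}. \<bar>z n x\<bar> \<le> J)"
    if cd: "a < c" "c < d" "d < b" for c d
  proof -
    obtain N where N: "\<And>n. n \<ge> N \<Longrightarrow> a + e n < c \<and> d < b - e n"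
      using exhaust[OF cd(1,3)] by blast
    obtain K where K: "\<And>x s. x \<in> {c..d} \<Longrightarrow> v x \<le> s \<Longrightarrow> \<bar>f s\<bar> \<le> K"
      using f_bounded_above_subsolution[OF cd] by metis
    have K0: "0 \<le> K" using K[of c "v c"] cd by simp
    have md: "m absolutely_integrable_on {c..d}"
      using cd by (intro absolutely_integrable_on_subinterval[OF m]) auto
    then have Km: "(\<lambda>s. K * \<bar>m s\<bar>) integrable_on {c..d}"
      by (intro integrable_on_mult_right) (simp add: absolutely_integrable_on_def)
    \<comment> \<open>\<open>B\<close> bounds the flux at one mean value point \<open>\<xi>\<close>,
      where the slope is the difference of two numbers between 0 and \<open>W\<close> divided by
      \<open>d - c\<close>. \<open>T\<close> bounds the change of the flux from there.\<close>
    define B where "B = (W / (d - c)) powr (1 / r)"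
    define T where "T = integral {c..d} (\<lambda>s. K * \<bar>m s\<bar>)"
    have "\<bar>z n x\<bar> \<le> B + T" if n: "n \<ge> N" and x: "x \<in> {c..d}" for n x
    proof -
      have sub: "{c..d} \<subseteq> {a + e n..b - e n}"
        using N[OF n] by auto
      have du: "(u0 n has_real_derivative spow r (z n t)) (at t within {c..d})" if "t \<in> {c..d}" for t
        using DERIV_subset[OF u0 sub] that sub by blast
      have "\<exists>\<xi>\<in>{c<..<d}. u0 n d - u0 n c = (\<lambda>h. h * spow r (z n \<xi>)) (d - c)"
      proof (rule mvt_simple[OF cd(2)])
        show "(u0 n has_derivative (\<lambda>h. h * spow r (z n t))) (at t within {c..d})" if "c \<le> t" "t \<le> d" for t
          using du[of t] that by (simp add: has_field_derivative_def mult_commute_abs)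
      qed
      then obtain \<xi> where \<xi>: "\<xi> \<in> {c<..<d}" "u0 n d - u0 n c = (d - c) * spow r (z n \<xi>)"
        by auto
      have "0 \<le> u0 n t \<and> u0 n t \<le> W" if "t \<in> {c..d}" for t
        using between[of t n] W[of t] v0[of t] that sub cd by force
      from this[of c] this[of d] have "\<bar>(d - c) * spow r (z n \<xi>)\<bar> \<le> W"
        unfolding \<xi>(2)[symmetric] using cd by (auto simp: abs_le_iff)
      then have "\<bar>z n \<xi>\<bar> powr r \<le> W / (d - c)"
        using cd by (simp add: abs_mult abs_spow pos_le_divide_eq mult.commute)
      then have "(\<bar>z n \<xi>\<bar> powr r) powr (1 / r) \<le> B"
        unfolding B_def using r by (intro powr_mono2) auto
      then have z\<xi>: "\<bar>z n \<xi>\<bar> \<le> B"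
        using r by (simp add: powr_powr)
      have diff: "\<bar>z n s - z n t\<bar> \<le> T" if st: "c \<le> s" "s \<le> t" "t \<le> d" for s t
      proof -
        have hi: "((\<lambda>s. m s * f (u0 n s)) has_integral (z n s - z n t)) {s..t}"
          using st N[OF n] by (intro z) auto
        then have "z n s - z n t = integral {s..t} (\<lambda>s. m s * f (u0 n s))"
          by (simp add: integral_unique)
        also have "norm \<dots> \<le> integral {s..t} (\<lambda>s. K * \<bar>m s\<bar>)"
        proof (rule Henstock_Kurzweil_Integration.integral_norm_bound_integral)
          show "(\<lambda>s. m s * f (u0 n s)) integrable_on {s..t}"
            using hi by blast
          show "(\<lambda>s. K * \<bar>m s\<bar>) integrable_on {s..t}"
            using Km st by (auto intro: integrable_on_subinterval)
          fix q assume "q \<in> {s..t}"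
          then have "\<bar>f (u0 n q)\<bar> \<le> K"
            using between[of q n] sub st by (intro K[of q]) auto
          then have "\<bar>m q\<bar> * \<bar>f (u0 n q)\<bar> \<le> \<bar>m q\<bar> * K"
            by (rule mult_left_mono) simp
          then show "norm (m q * f (u0 n q)) \<le> K * \<bar>m q\<bar>"
            by (simp add: abs_mult mult.commute)
        qed
        also have "\<dots> \<le> T"
          unfolding T_def using st K0 Km
          by (intro integral_subset_le) (auto intro: integrable_on_subinterval)
        finally show ?thesis by simp
      qed
      have "\<bar>z n x - z n \<xi>\<bar> \<le> T"
        using diff[of x \<xi>] diff[of \<xi> x] x \<xi>(1) by (cases "x \<le> \<xi>") (auto simp: abs_minus_commute)
      then show ?thesis using z\<xi> by linarith
    qed
    with N show ?thesis by blast
  qed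
  have lipschitz: "\<exists>L\<ge>0. \<exists>N. \<forall>n\<ge>N. \<forall>x\<in>{c..d}. \<forall>y\<in>{c..d}. \<bar>U n y - U n x\<bar> \<le> L * \<bar>y - x\<bar>"
    if cd: "a < c" "c < d" "d < b" for c d
  proof -
    obtain J N where JN: "\<And>n. n \<ge> N \<Longrightarrow> a + e n < c \<and> d < b - e n \<and> (\<forall>x\<in>{c..d}. \<bar>z n x\<bar> \<le> J)"
      using local_bound[OF cd] by blast
    have "\<bar>U n y - U n x\<bar> \<le> J powr r * \<bar>y - x\<bar>" if n: "n \<ge> N" and xy: "x \<in> {c..d}" "y \<in> {c..d}" for n x y
    proof -
      have sub: "{c..d} \<subseteq> {a + e n..b - e n}"
        using JN[OF n] by auto
      have "norm (u0 n y - u0 n x) \<le> J powr r * norm (y - x)"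
      proof (rule field_differentiable_bound[OF convex_real_interval(5)])
        show "(u0 n has_field_derivative spow r (z n t)) (at t within {c..d})" if "t \<in> {c..d}" for t
          using DERIV_subset[OF u0 sub] that sub by blast
        show "norm (spow r (z n t)) \<le> J powr r" if "t \<in> {c..d}" for t
          using JN[OF n] that r by (auto simp: abs_spow intro!: powr_mono2)
      qed (use xy in auto)
      then show ?thesis
        using xy sub by (auto simp: U_def)
    qed
    then show ?thesis
      by (intro exI[of _ "J powr r"] conjI exI[of _ N]) auto
  qed

  \<comment> \<open>Choice of a subsequence for the functions and their fluxes\<close>
  obtain \<rho> where \<rho>: "strict_mono \<rho>" "\<And>x. x \<in> {a<..<b} \<Longrightarrow> convergent (\<lambda>n. U (\<rho> n) x)"
  proof (rule equicontinuous_pointwise_convergent_subsequence[of "{a<..<b}" U])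
    fix x assume x: "x \<in> {a<..<b}"
    show "\<exists>M. \<forall>n. \<bar>U n x\<bar> \<le> M"
    proof (intro exI allI)
      show "\<bar>U n x\<bar> \<le> w x" for n
        using U[of x n] v0[of x] x by simp
    qed
    fix \<epsilon> :: real assume "0 < \<epsilon>"
    define c where "c = (a + x) / 2"
    define d where "d = (x + b) / 2"
    have cd: "a < c" "c < x" "x < d" "d < b"
      using x by (auto simp: c_def d_def)
    obtain L N where L: "0 \<le> L" and
      LN': "\<forall>n\<ge>N. \<forall>x\<in>{c..d}. \<forall>y\<in>{c..d}. \<bar>U n y - U n x\<bar> \<le> L * \<bar>y - x\<bar>"
      using lipschitz[OF cd(1) order.strict_trans[OF cd(2,3)] cd(4)] by blast
    have LN: "\<bar>U n y - U n x\<bar> \<le> L * \<bar>y - x\<bar>" if "n \<ge> N" "y \<in> {c..d}" for n y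
      using LN' that cd by simp
    show "\<exists>\<delta>>0. \<exists>N. \<forall>n\<ge>N. \<forall>y\<in>{a<..<b}. \<bar>y - x\<bar> < \<delta> \<longrightarrow> \<bar>U n y - U n x\<bar> < \<epsilon>"
    proof (intro exI conjI allI ballI impI)
      show "0 < min (min (x - c) (d - x)) (\<epsilon> / (L + 1))"
        using cd \<open>0 < \<epsilon>\<close> L by simp
      fix n y assume n: "n \<ge> N" and y: "\<bar>y - x\<bar> < min (min (x - c) (d - x)) (\<epsilon> / (L + 1))"
      then have "\<bar>U n y - U n x\<bar> \<le> L * \<bar>y - x\<bar>" by (intro LN) auto
      also have "\<dots> \<le> (L + 1) * \<bar>y - x\<bar>" by (simp add: mult_right_mono)
      also have "\<dots> < \<epsilon>" using y L by (simp add: less_divide_eq mult.commute)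
      finally show "\<bar>U n y - U n x\<bar> < \<epsilon>" .
    qed
  qed (rule that)
  define u where "u x = (if x \<in> {a<..<b} then lim (\<lambda>n. U (\<rho> n) x) else 0)" for x
  have lim_u: "(\<lambda>n. U (\<rho> n) x) \<longlonglongrightarrow> u x" if "x \<in> {a<..<b}" for x
    using \<rho>(2)[OF that] that by (simp add: u_def convergent_LIMSEQ_iff)
  have uvw: "v x \<le> u x" "u x \<le> w x" if "x \<in> {a<..<b}" for x
    using U[of x] that by (auto intro!: LIMSEQ_le_const[OF lim_u[OF that]] LIMSEQ_le_const2[OF lim_u[OF that]])
  define mid where "mid = (a + b) / 2"
  have mid: "a < mid" "mid < b" using ab by (auto simp: mid_def)
  \<comment> \<open>The integrated equation controls only increments of the fluxes. A further
    subsequence converging at the single point \<open>mid\<close> gives convergence everywhere; the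
    index shift by \<open>N\<close> reaches the range in which the local bound holds.\<close>
  obtain \<sigma> l where \<sigma>: "strict_mono \<sigma>" "(\<lambda>n. z (\<rho> (\<sigma> n)) mid) \<longlonglongrightarrow> l"
  proof -
    obtain J N where JN: "\<And>n. n \<ge> N \<Longrightarrow> \<bar>z n mid\<bar> \<le> J"
    proof -
      have "a < (a + mid) / 2" "(a + mid) / 2 < (mid + b) / 2" "(mid + b) / 2 < b"
        using mid by auto
      then obtain J N where
        "\<And>n. n \<ge> N \<Longrightarrow> (\<forall>x\<in>{(a + mid) / 2..(mid + b) / 2}. \<bar>z n x\<bar> \<le> J)"
        using local_bound by blast
      moreover have "mid \<in> {(a + mid) / 2..(mid + b) / 2}"
        using mid by auto
      ultimately show thesis
        using that[of N J] by blast
    qed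
    have "\<bar>z (\<rho> (n + N)) mid\<bar> \<le> J" for n
      using JN seq_suble[OF \<rho>(1), of "n + N"] by simp
    then have "bounded (range (\<lambda>n. z (\<rho> (n + N)) mid))"
      by (intro boundedI[of _ J]) auto
    from bounded_imp_convergent_subsequence[OF this] obtain l s
      where s: "strict_mono s" "((\<lambda>n. z (\<rho> (n + N)) mid) \<circ> s) \<longlonglongrightarrow> l"
      by auto
    show thesis
    proof (rule that[of "\<lambda>n. s n + N"])
      show "strict_mono (\<lambda>n. s n + N)"
        using s(1) by (simp add: strict_mono_def)
      show "(\<lambda>n. z (\<rho> (s n + N)) mid) \<longlonglongrightarrow> l"
        using s(2) by (simp add: o_def)
    qed
  qed
  define \<tau> where "\<tau> n = \<rho> (\<sigma> n)" for n
  have \<tau>: "strict_mono \<tau>"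
    using \<rho>(1) \<sigma>(1) by (simp add: \<tau>_def strict_mono_def)
  have \<tau>n: "n \<le> \<tau> n" for n by (rule seq_suble[OF \<tau>])
  have lim_u: "(\<lambda>n. U (\<tau> n) x) \<longlonglongrightarrow> u x" if "a < x" "x < b" for x
    using LIMSEQ_subseq_LIMSEQ[OF lim_u \<sigma>(1), of x] that by (simp add: o_def \<tau>_def)

  \<comment> \<open>Passage to the limit in both equations\<close>
  have lim_diff: "(\<lambda>s. m s * f (u s)) integrable_on {x..y}"
    "(\<lambda>n. z (\<tau> n) x - z (\<tau> n) y) \<longlonglongrightarrow> integral {x..y} (\<lambda>s. m s * f (u s))"
    if xy: "a < x" "x \<le> y" "y < b" for x y
  proof -
    define d where "d = (y + b) / 2"
    have d: "y < d" "d < b" using xy by (auto simp: d_def)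
    obtain N where N: "\<And>n. n \<ge> N \<Longrightarrow> a + e n < x \<and> y < b - e n"
      using exhaust[OF xy(1,3)] by blast
    obtain K where K: "\<And>t s. t \<in> {x..d} \<Longrightarrow> v t \<le> s \<Longrightarrow> \<bar>f s\<bar> \<le> K"
      using f_bounded_above_subsolution[of x d] xy d by (metis order_le_less_trans)
    have hi: "((\<lambda>s. m s * f (U (\<tau> (n + N)) s)) has_integral (z (\<tau> (n + N)) x - z (\<tau> (n + N)) y)) {x..y}" for n
    proof -
      have n: "N \<le> \<tau> (n + N)" using \<tau>n[of "n + N"] by simp
      show ?thesis
      proof (rule has_integral_eq)
        show "((\<lambda>s. m s * f (u0 (\<tau> (n + N)) s)) has_integral (z (\<tau> (n + N)) x - z (\<tau> (n + N)) y)) {x..y}"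
          using N[OF n] xy by (intro z) auto
        show "m s * f (u0 (\<tau> (n + N)) s) = m s * f (U (\<tau> (n + N)) s)" if "s \<in> {x..y}" for s
          using that N[OF n] by (auto simp: U_def)
      qed
    qed
    have "m absolutely_integrable_on {x..y}"
      using xy by (intro absolutely_integrable_on_subinterval[OF m]) auto
    then have Km: "(\<lambda>s. K * \<bar>m s\<bar>) integrable_on {x..y}"
      by (intro integrable_on_mult_right) (simp add: absolutely_integrable_on_def)
    have bound: "norm (m s * f (U (\<tau> (n + N)) s)) \<le> K * \<bar>m s\<bar>" if s: "s \<in> {x..y}" for n s
    proof -
      have "\<bar>f (U (\<tau> (n + N)) s)\<bar> \<le> K"
        using U[of s] s xy d by (intro K[of s]) auto
      then have "\<bar>m s\<bar> * \<bar>f (U (\<tau> (n + N)) s)\<bar> \<le> \<bar>m s\<bar> * K"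
        by (rule mult_left_mono) simp
      then show ?thesis by (simp add: abs_mult mult.commute)
    qed
    have conv: "(\<lambda>n. m s * f (U (\<tau> (n + N)) s)) \<longlonglongrightarrow> m s * f (u s)" if s: "s \<in> {x..y}" for s
    proof -
      have sab: "a < s" "s < b" using s xy by auto
      have "0 < u s" using uvw[of s] v0[of s] sab by auto
      then have "isCont f (u s)"
        using cf by (simp add: continuous_on_eq_continuous_at)
      then have "(\<lambda>n. f (U (\<tau> (n + N)) s)) \<longlonglongrightarrow> f (u s)"
        by (rule isCont_tendsto_compose[OF _ LIMSEQ_ignore_initial_segment[OF lim_u[OF sab]]])
      then show ?thesis by (intro tendsto_intros)
    qed
    note dom = Equivalence_Lebesgue_Henstock_Integration.dominated_convergence
      [of "\<lambda>n s. m s * f (U (\<tau> (n + N)) s)", OF has_integral_integrable[OF hi] Km bound conv]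
    show "(\<lambda>s. m s * f (u s)) integrable_on {x..y}"
      by (rule dom(1))
    have "(\<lambda>n. z (\<tau> (n + N)) x - z (\<tau> (n + N)) y) \<longlonglongrightarrow> integral {x..y} (\<lambda>s. m s * f (u s))"
      using dom(2) by (simp add: integral_unique[OF hi])
    then show "(\<lambda>n. z (\<tau> n) x - z (\<tau> n) y) \<longlonglongrightarrow> integral {x..y} (\<lambda>s. m s * f (u s))"
      by (rule LIMSEQ_offset)
  qed
  define Z where "Z x = lim (\<lambda>n. z (\<tau> n) x)" for x
  have lim_Z: "(\<lambda>n. z (\<tau> n) x) \<longlonglongrightarrow> Z x" if x: "a < x" "x < b" for x
  proof -
    have zmid: "(\<lambda>n. z (\<tau> n) mid) \<longlonglongrightarrow> l"
      using \<sigma>(2) by (simp add: \<tau>_def)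
    have "convergent (\<lambda>n. z (\<tau> n) x)"
    proof (cases "x \<le> mid")
      case True
      from tendsto_add[OF lim_diff(2)[OF x(1) True mid(2)] zmid] show ?thesis
        by (auto simp: convergent_def)
    next
      case False
      then have "mid \<le> x" by simp
      from tendsto_diff[OF zmid lim_diff(2)[OF mid(1) this x(2)]] show ?thesis
        by (auto simp: convergent_def)
    qed
    then show ?thesis by (simp add: Z_def convergent_LIMSEQ_iff)
  qed
  have hZ: "((\<lambda>s. m s * f (u s)) has_integral (Z x - Z y)) {x..y}" if xy: "a < x" "x \<le> y" "y < b" for x y
  proof -
    have "(\<lambda>n. z (\<tau> n) x - z (\<tau> n) y) \<longlonglongrightarrow> Z x - Z y"
      using xy by (intro tendsto_diff lim_Z) auto
    then have "integral {x..y} (\<lambda>s. m s * f (u s)) = Z x - Z y"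
      using lim_diff(2)[OF xy] LIMSEQ_unique by blast
    then show ?thesis
      using lim_diff(1)[OF xy] by (simp add: has_integral_iff)
  qed
  have du: "(u has_real_derivative spow r (Z x)) (at x)" if x: "a < x" "x < b" for x
  proof -
    define c where "c = (a + x) / 2"
    define d where "d = (x + b) / 2"
    have cd: "a < c" "c < x" "x < d" "d < b"
      using x by (auto simp: c_def d_def)
    have cZ: "continuous_on {c..d} Z"
      using hZ cd by (intro continuous_on_indefinite[of c d "\<lambda>s. m s * f (u s)"]) auto
    obtain J N where JN: "\<And>n. n \<ge> N \<Longrightarrow> a + e n < c \<and> d < b - e n \<and> (\<forall>x\<in>{c..d}. \<bar>z n x\<bar> \<le> J)"
      using local_bound[OF cd(1) order.strict_trans[OF cd(2,3)] cd(4)] by blast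
    \<comment> \<open>The limit is taken in the integrated form, where bounded fluxes suffice for
      dominated convergence; continuity of \<open>Z\<close> then returns the pointwise
      derivative.\<close>
    have ut: "u t = u c + integral {c..t} (\<lambda>s. spow r (Z s))" if t: "t \<in> {c..d}" for t
    proof -
      have hi: "((\<lambda>s. spow r (z (\<tau> (n + N)) s)) has_integral (U (\<tau> (n + N)) t - U (\<tau> (n + N)) c)) {c..t}" for n
      proof -
        have n: "N \<le> \<tau> (n + N)" using \<tau>n[of "n + N"] by simp
        have sub: "{c..t} \<subseteq> {a + e (\<tau> (n + N))..b - e (\<tau> (n + N))}"
          using JN[OF n] t by auto
        have "((\<lambda>s. spow r (z (\<tau> (n + N)) s)) has_integral (u0 (\<tau> (n + N)) t - u0 (\<tau> (n + N)) c)) {c..t}"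
        proof (rule fundamental_theorem_of_calculus)
          show "(u0 (\<tau> (n + N)) has_vector_derivative spow r (z (\<tau> (n + N)) s)) (at s within {c..t})"
            if "s \<in> {c..t}" for s
            using DERIV_subset[OF u0 sub] that sub
            unfolding has_real_derivative_iff_has_vector_derivative by blast
        qed (use t in auto)
        moreover have "t \<in> {a + e (\<tau> (n + N))..b - e (\<tau> (n + N))}" "c \<in> {a + e (\<tau> (n + N))..b - e (\<tau> (n + N))}"
          using sub t by auto
        ultimately show ?thesis by (simp add: U_def)
      qed
      have bound: "norm (spow r (z (\<tau> (n + N)) s)) \<le> J powr r" if "s \<in> {c..t}" for n s
      proof -
        have "\<bar>z (\<tau> (n + N)) s\<bar> \<le> J"
          using JN[of "\<tau> (n + N)"] \<tau>n[of "n + N"] that t by auto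
        then show ?thesis
          using r by (auto simp: abs_spow intro!: powr_mono2)
      qed
      have conv: "(\<lambda>n. spow r (z (\<tau> (n + N)) s)) \<longlonglongrightarrow> spow r (Z s)" if "s \<in> {c..t}" for s
        using that t cd by (intro tendsto_spow r LIMSEQ_ignore_initial_segment lim_Z) auto
      have "(\<lambda>n. U (\<tau> (n + N)) t - U (\<tau> (n + N)) c) \<longlonglongrightarrow> integral {c..t} (\<lambda>s. spow r (Z s))"
        using Equivalence_Lebesgue_Henstock_Integration.dominated_convergence(2)
          [of "\<lambda>n s. spow r (z (\<tau> (n + N)) s)", OF has_integral_integrable[OF hi] integrable_const_ivl bound conv]
        by (simp add: integral_unique[OF hi])
      moreover have "(\<lambda>n. U (\<tau> (n + N)) t - U (\<tau> (n + N)) c) \<longlonglongrightarrow> u t - u c"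
        using t cd by (intro tendsto_diff LIMSEQ_ignore_initial_segment lim_u) auto
      ultimately have "integral {c..t} (\<lambda>s. spow r (Z s)) = u t - u c"
        by (rule LIMSEQ_unique)
      then show ?thesis by simp
    qed
    have xcd: "x \<in> {c..d}" using cd by simp
    have "(u has_real_derivative spow r (Z x)) (at x within {c..d})"
    proof (rule has_field_derivative_transform_within[OF _ zero_less_one xcd])
      show "((\<lambda>t. u c + integral {c..t} (\<lambda>s. spow r (Z s))) has_real_derivative spow r (Z x)) (at x within {c..d})"
        using integral_has_real_derivative[OF continuous_on_spow[OF r cZ] xcd]
        by (auto intro!: derivative_eq_intros)
    qed (rule ut[symmetric])
    then show ?thesis using cd by (simp add: at_within_Icc_at)
  qed

  \<comment> \<open>Continuity at the boundary\<close>
  have endpoint: "continuous (at x within {a..b}) u" if x: "x = a \<or> x = b" for x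
    unfolding continuous_within
  proof -
    have ux: "u x = 0" using x by (auto simp: u_def)
    have "(w \<longlongrightarrow> w x) (at x within {a..b})"
      using cw x ab by (auto simp: continuous_on_def)
    then have "(w \<longlongrightarrow> 0) (at x within {a..b})"
      using x wa wb by auto
    then have "(u \<longlongrightarrow> 0) (at x within {a..b})"
    proof (rule Lim_null_comparison[rotated])
      show "\<forall>\<^sub>F t in at x within {a..b}. norm (u t) \<le> w t"
        unfolding eventually_at_filter
      proof (intro always_eventually allI impI)
        fix t assume "t \<noteq> x" "t \<in> {a..b}"
        then show "norm (u t) \<le> w t"
          using uvw[of t] v0[of t] wa wb by (cases "t \<in> {a<..<b}") (auto simp: u_def)
      qed
    qed
    then show "(u \<longlongrightarrow> u x) (at x within {a..b})" by (simp add: ux)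
  qed
  show thesis
  proof (rule that[of u Z])
    show "continuous_on {a..b} u"
      unfolding continuous_on_eq_continuous_within
    proof
      fix x assume "x \<in> {a..b}"
      then consider "x = a \<or> x = b" | "a < x" "x < b" by force
      then show "continuous (at x within {a..b}) u"
      proof cases
        case 2
        then show ?thesis
          using DERIV_isCont[OF du] continuous_at_imp_continuous_at_within by blast
      qed (rule endpoint)
    qed
    show "u a = 0" "u b = 0" by (simp_all add: u_def)
    show "0 < u x" if "a < x" "x < b" for x
      using uvw[of x] v0[OF that] that by auto
  qed (rule du hZ; assumption)+
qed

end

section \<open>Weak solutions\<close>

lemma powr_mult_self: "\<bar>s :: real\<bar> powr (p - 2) * s = spow (p - 1) s"
proof (cases "s = 0")
  case False
  have "\<bar>s\<bar> powr (p - 2) * s = sgn s * (\<bar>s\<bar> powr (p - 2) * \<bar>s\<bar> powr 1)"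
    using False by (simp add: sgn_mult_abs mult.left_commute)
  also have "\<dots> = spow (p - 1) s"
    using powr_add[of "\<bar>s\<bar>" "p - 2" 1] by (simp add: spow_def)
  finally show ?thesis .
qed simp

text \<open>The flux is \<open>spow (p - 1)\<close> of the continuous derivative of
  \<open>u\<close>, so the lemma of du Bois-Reymond applies to it, and \<open>spow_inverse\<close>
  recovers the derivative.\<close>

lemma dirichlet_solution_flux:
  fixes p a b :: real
  assumes p: "1 < p" and sol: "dirichlet_solution p a b F u"
    and F: "\<And>c d. a < c \<Longrightarrow> d < b \<Longrightarrow> (\<lambda>x. F x (u x)) absolutely_integrable_on {c..d}"
  obtains z where
    "\<And>x. a < x \<Longrightarrow> x < b \<Longrightarrow> (u has_real_derivative spow (1 / (p - 1)) (z x)) (at x)"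
    "\<And>x y. a < x \<Longrightarrow> x \<le> y \<Longrightarrow> y < b \<Longrightarrow> ((\<lambda>x. F x (u x)) has_integral (z x - z y)) {x..y}"
proof -
  obtain D where D: "\<And>x. x \<in> {a<..<b} \<Longrightarrow> (u has_vector_derivative D x) (at x)"
    and cD: "continuous_on {a<..<b} D"
  proof -
    have "u C1_differentiable_on {a<..<b}"
      using sol by (simp add: dirichlet_solution_def)
    then show thesis
      unfolding C1_differentiable_on_def using that by blast
  qed
  have dD: "(u has_real_derivative D x) (at x)" "deriv u x = D x" if "x \<in> {a<..<b}" for x
    using D[OF that] by (auto simp: has_real_derivative_iff_has_vector_derivative[symmetric] DERIV_imp_deriv)
  define z where "z x = spow (p - 1) (D x)" for x
  have inv: "spow (1 / (p - 1)) (z x) = D x" for x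
    unfolding z_def using p by (intro spow_inverse) simp
  have cz: "continuous_on {a<..<b} z"
    unfolding z_def using p cD by (intro continuous_on_spow) auto
  show thesis
  proof (rule that[of z])
    show "(u has_real_derivative spow (1 / (p - 1)) (z x)) (at x)" if "a < x" "x < b" for x
      using dD[of x] that by (simp add: inv)
    show "((\<lambda>x. F x (u x)) has_integral (z x - z y)) {x..y}" if "a < x" "x \<le> y" "y < b" for x y
    proof (rule du_Bois_Reymond[OF cz F _ that])
      fix \<phi> assume \<phi>: "test_function {a<..<b} \<phi>"
      have "(LINT x:{a<..<b}|lebesgue. z x * deriv \<phi> x) =
          (LINT x:{a<..<b}|lebesgue. \<bar>deriv u x\<bar> powr (p - 2) * deriv u x * deriv \<phi> x)"
        by (intro set_lebesgue_integral_cong) (auto simp: dD powr_mult_self z_def)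
      also have "\<dots> = (LINT x:{a<..<b}|lebesgue. F x (u x) * \<phi> x)"
        using sol \<phi> by (simp add: dirichlet_solution_def)
      finally show "(LINT x:{a<..<b}|lebesgue. z x * deriv \<phi> x) =
          (LINT x:{a<..<b}|lebesgue. F x (u x) * \<phi> x)" .
    qed
  qed
qed

text \<open>The points \<open>c\<close> and \<open>d\<close> are chosen strictly outside the
  support, so that \<open>\<phi>\<close> vanishes at both of them and no boundary terms survive
  integration by parts.\<close>

lemma test_function_props:
  assumes ab: "a < b" and \<phi>: "test_function {a<..<b} \<phi>"
  obtains c d where "a < c" "c < d" "d < b"
    "\<And>x. x \<le> c \<or> d \<le> x \<Longrightarrow> \<phi> x = 0" "\<And>x. x < c \<or> d < x \<Longrightarrow> deriv \<phi> x = 0"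
    "\<And>x. (\<phi> has_real_derivative deriv \<phi> x) (at x)" "continuous_on UNIV (deriv \<phi>)"
proof -
  \<comment> \<open>The midpoint keeps \<open>S\<close> nonempty when \<open>\<phi>\<close> is
    identically 0, so that its minimum and maximum exist.\<close>
  define S where "S = insert ((a + b) / 2) (closure {x. \<phi> x \<noteq> 0})"
  note \<phi>' = \<phi>[unfolded test_function_def]
  have diff: "((deriv ^^ k) \<phi>) differentiable_on UNIV" for k
    by (rule \<phi>'[THEN conjunct1, THEN spec])
  have cl: "closure {x. \<phi> x \<noteq> 0} \<subseteq> {a<..<b}"
    by (rule \<phi>'[THEN conjunct2, THEN conjunct2])
  have "compact (closure {x. \<phi> x \<noteq> 0})"
    by (rule \<phi>'[THEN conjunct2, THEN conjunct1])
  then have S: "compact S" "S \<noteq> {}"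
    unfolding S_def by (rule compact_insert) simp
  have S': "S \<subseteq> {a<..<b}"
    using cl ab by (simp add: S_def)
  obtain c0 where c0: "c0 \<in> S" "\<forall>x\<in>S. c0 \<le> x"
    using compact_attains_inf[OF S] by blast
  obtain d0 where d0: "d0 \<in> S" "\<forall>x\<in>S. x \<le> d0"
    using compact_attains_sup[OF S] by blast
  define c where "c = (a + c0) / 2"
  define d where "d = (d0 + b) / 2"
  have cd: "a < c" "c < c0" "c0 \<le> d0" "d0 < d" "d < b"
    using subsetD[OF S' c0(1)] subsetD[OF S' d0(1)] bspec[OF c0(2) d0(1)]
    by (auto simp: c_def d_def)
  have zero: "\<phi> x = 0" if "x \<le> c \<or> d \<le> x" for x
  proof (rule ccontr)
    assume "\<phi> x \<noteq> 0"
    then have "x \<in> S"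
      using closure_subset[of "{x. \<phi> x \<noteq> 0}"] by (auto simp: S_def)
    then have "c0 \<le> x" "x \<le> d0" using c0(2) d0(2) by auto
    then show False using cd that by linarith
  qed
  have "\<phi> differentiable (at x)" for x
    using diff[of 0] by (simp add: differentiable_on_def)
  then have d\<phi>: "(\<phi> has_real_derivative deriv \<phi> x) (at x)" for x
    by (simp add: DERIV_deriv_iff_real_differentiable)
  show thesis
  proof (rule that[of c d])
    show "c < d" using cd by simp
    show "deriv \<phi> x = 0" if "x < c \<or> d < x" for x
    proof (rule DERIV_imp_deriv)
      have "open ({..<c} \<union> {d<..})" by auto
      then have "\<forall>\<^sub>F y in nhds x. \<phi> y = 0"
        using that zero by (intro eventually_nhds_in_open[THEN eventually_mono]) auto
      then show "(\<phi> has_real_derivative 0) (at x)"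
        by (subst DERIV_cong_ev[OF refl _ refl, where g = "\<lambda>_. 0"]) auto
    qed
    show "continuous_on UNIV (deriv \<phi>)"
      using diff[of 1] by (simp add: differentiable_imp_continuous_on)
  qed (use cd zero d\<phi> in auto)
qed

text \<open>Integration by parts against a test function on an interval containing its support; the
  flux, continuous on compact subintervals, supplies the continuous derivative required for
  C1.\<close>

lemma dirichlet_solutionI:
  fixes p a b :: real
  assumes ab: "a < b" and p: "1 < p"
    and u: "continuous_on {a..b} u" "u a = 0" "u b = 0" "\<And>x. a < x \<Longrightarrow> x < b \<Longrightarrow> 0 < u x"
    and F: "\<And>c d. a < c \<Longrightarrow> d < b \<Longrightarrow> (\<lambda>x. F x (u x)) absolutely_integrable_on {c..d}"
    and du: "\<And>x. a < x \<Longrightarrow> x < b \<Longrightarrow> (u has_real_derivative spow (1 / (p - 1)) (z x)) (at x)"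
    and z: "\<And>x y. a < x \<Longrightarrow> x \<le> y \<Longrightarrow> y < b \<Longrightarrow> ((\<lambda>x. F x (u x)) has_integral (z x - z y)) {x..y}"
  shows "dirichlet_solution p a b F u"
  unfolding dirichlet_solution_def
proof (intro conjI allI impI ballI)
  let ?D = "\<lambda>x. spow (1 / (p - 1)) (z x)"
  have cz: "continuous_on {c..d} z" if "a < c" "d < b" for c d
    using z that by (intro continuous_on_indefinite[of c d "\<lambda>x. F x (u x)"]) auto
  have "isCont z x" if x: "x \<in> {a<..<b}" for x
  proof -
    have "continuous_on {(a + x) / 2..(x + b) / 2} z"
      using x by (intro cz) auto
    moreover have "x \<in> interior {(a + x) / 2..(x + b) / 2}"
      using x by auto
    ultimately show ?thesis by (rule continuous_on_interior)
  qed
  then have "continuous_on {a<..<b} z"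
    by (simp add: continuous_at_imp_continuous_on)
  then have "continuous_on {a<..<b} ?D"
    using p by (intro continuous_on_spow) auto
  then show "u C1_differentiable_on {a<..<b}"
    unfolding C1_differentiable_on_def
    using du by (intro exI[of _ ?D]) (simp add: has_real_derivative_iff_has_vector_derivative)
  fix \<phi> assume \<phi>: "test_function {a<..<b} \<phi>"
  obtain c d where cd: "a < c" "c < d" "d < b"
    and zero: "\<And>x. x \<le> c \<or> d \<le> x \<Longrightarrow> \<phi> x = 0" "\<And>x. x < c \<or> d < x \<Longrightarrow> deriv \<phi> x = 0"
    and d\<phi>: "\<And>x. (\<phi> has_real_derivative deriv \<phi> x) (at x)" "continuous_on UNIV (deriv \<phi>)"
    by (rule test_function_props[OF ab \<phi>]) (rule that)
  have sub: "{c..d} \<subseteq> {a<..<b}" using cd by auto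
  have c\<phi>': "continuous_on {c..d} (deriv \<phi>)"
    using d\<phi>(2) by (rule continuous_on_subset) simp
  have c\<phi>: "continuous_on {c..d} \<phi>"
    by (rule DERIV_continuous_on[OF has_field_derivative_at_within[OF d\<phi>(1)]])
  have Fcd: "(\<lambda>x. F x (u x)) absolutely_integrable_on {c..d}"
    using cd by (intro F) auto
  have F\<phi>: "(\<lambda>x. F x (u x) * \<phi> x) absolutely_integrable_on {c..d}"
    by (rule absolutely_integrable_mult_continuous[OF Fcd c\<phi>])
  show "set_integrable lebesgue {a<..<b} (\<lambda>x. F x (u x) * \<phi> x)"
    using zero by (intro zero_extension_set_integral(1)[OF F\<phi> sub]) auto
  have z\<phi>: "(\<lambda>x. z x * deriv \<phi> x) absolutely_integrable_on {c..d}"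
    using cd by (intro absolutely_integrable_continuous_real continuous_intros cz c\<phi>') auto
  have "((\<lambda>t. z t * deriv \<phi> t - F t (u t) * \<phi> t) has_integral (z d * \<phi> d - z c * \<phi> c)) {c..d}"
  proof (rule integration_by_parts_indefinite[OF less_imp_le[OF cd(2)] _ Fcd _ c\<phi>'])
    show "((\<lambda>x. F x (u x)) has_integral z x - z y) {x..y}" if "c \<le> x" "x \<le> y" "y \<le> d" for x y
      using that cd by (intro z) auto
    show "(\<phi> has_real_derivative deriv \<phi> x) (at x within {c..d})" for x
      by (rule has_field_derivative_at_within[OF d\<phi>(1)])
  qed
  then have "((\<lambda>t. z t * deriv \<phi> t - F t (u t) * \<phi> t) has_integral 0) {c..d}"
    using zero by simp
  then have "integral {c..d} (\<lambda>t. z t * deriv \<phi> t - F t (u t) * \<phi> t) = 0"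
    by (rule integral_unique)
  then have eq: "integral {c..d} (\<lambda>t. z t * deriv \<phi> t) = integral {c..d} (\<lambda>t. F t (u t) * \<phi> t)"
    using set_lebesgue_integral_eq_integral(1)[OF z\<phi>] set_lebesgue_integral_eq_integral(1)[OF F\<phi>]
    by (simp add: Henstock_Kurzweil_Integration.integral_diff)
  have "(LINT x:{a<..<b}|lebesgue. \<bar>deriv u x\<bar> powr (p - 2) * deriv u x * deriv \<phi> x) =
      (LINT x:{a<..<b}|lebesgue. z x * deriv \<phi> x)"
  proof (rule set_lebesgue_integral_cong)
    show "\<forall>x. x \<in> {a<..<b} \<longrightarrow> \<bar>deriv u x\<bar> powr (p - 2) * deriv u x * deriv \<phi> x = z x * deriv \<phi> x"
    proof (intro allI impI)
      fix x assume "x \<in> {a<..<b}"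
      then have "deriv u x = ?D x"
        using du by (auto intro!: DERIV_imp_deriv)
      moreover have "spow (p - 1) (?D x) = z x"
        using p by (intro spow_inverse) simp
      ultimately show "\<bar>deriv u x\<bar> powr (p - 2) * deriv u x * deriv \<phi> x = z x * deriv \<phi> x"
        by (simp add: powr_mult_self)
    qed
  qed simp
  also have "\<dots> = integral {c..d} (\<lambda>t. z t * deriv \<phi> t)"
    using zero by (intro zero_extension_set_integral(2)[OF z\<phi> sub]) auto
  also have "\<dots> = (LINT x:{a<..<b}|lebesgue. F x (u x) * \<phi> x)"
    unfolding eq using zero by (intro zero_extension_set_integral(2)[OF F\<phi> sub, symmetric]) auto
  finally show "(LINT x:{a<..<b}|lebesgue. \<bar>deriv u x\<bar> powr (p - 2) * deriv u x * deriv \<phi> x) =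
      (LINT x:{a<..<b}|lebesgue. F x (u x) * \<phi> x)" .
qed (use u in auto)

theorem corollary3p5:
  fixes a b p \<gamma> c\<^sub>f C\<^sub>f :: real and m f :: "real \<Rightarrow> real"
  assumes "a < b" and "1 < p"
    and "in_Lp (p / (p - 1)) {a<..<b} m"
    and "continuous_on {0<..} f"
    and "\<And>\<xi>. 0 < \<xi> \<Longrightarrow> 0 < f \<xi>"
    and "0 < c\<^sub>f" and "0 < C\<^sub>f" and "0 < \<gamma>"
    and "\<And>\<xi>. 0 < \<xi> \<Longrightarrow> c\<^sub>f * \<xi> powr (- \<gamma>) \<le> f \<xi> \<and> f \<xi> \<le> C\<^sub>f * \<xi> powr (- \<gamma>)"
    and "\<exists>u. dirichlet_solution p a b
           (\<lambda>x s. (c\<^sub>f * max (m x) 0 - C\<^sub>f * max (- m x) 0) * s powr (- \<gamma>)) u"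
  shows "\<exists>u. dirichlet_solution p a b (\<lambda>x s. m x * f s) u"
proof -
  let ?r = "1 / (p - 1)"
  let ?g = "\<lambda>x. c\<^sub>f * max (m x) 0 - C\<^sub>f * max (- m x) 0"
  have r: "0 < ?r" using \<open>1 < p\<close> by simp
  have "1 \<le> p / (p - 1)" using \<open>1 < p\<close> by simp
  then have m: "m absolutely_integrable_on {a..b}"
    using assms(3) by (rule in_Lp_imp_absolutely_integrable)
  obtain v where v: "dirichlet_solution p a b (\<lambda>x s. ?g x * s powr (- \<gamma>)) v"
    using assms(10) by blast
  then have cv: "continuous_on {a..b} v" and v0: "\<And>x. a < x \<Longrightarrow> x < b \<Longrightarrow> 0 < v x"
    and vab: "v a = 0" "v b = 0"
    by (auto simp: dirichlet_solution_def)
  \<comment> \<open>Away from the endpoints \<open>v\<close> is positive and continuous, so the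
    singular power is a continuous factor of the integrable weight.\<close>
  have gi: "(\<lambda>x. ?g x * v x powr (- \<gamma>)) absolutely_integrable_on {c..d}" if cd: "a < c" "d < b" for c d
  proof (rule absolutely_integrable_mult_continuous)
    have md: "m absolutely_integrable_on {c..d}"
      using cd by (intro absolutely_integrable_on_subinterval[OF m]) auto
    have zero: "(\<lambda>x. 0 :: real) absolutely_integrable_on {c..d}" by simp
    have md': "(\<lambda>x. - m x) absolutely_integrable_on {c..d}"
      using set_integral_diff(1)[OF zero md] by simp
    have "(\<lambda>x. c\<^sub>f * max (m x) 0) absolutely_integrable_on {c..d}"
      "(\<lambda>x. C\<^sub>f * max (- m x) 0) absolutely_integrable_on {c..d}"
      by (intro set_integrable_mult_right absolutely_integrable_max_1 md md' zero)+
    then show "?g absolutely_integrable_on {c..d}"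
      by (rule set_integral_diff(1))
    have "v x \<noteq> 0" if "x \<in> {c..d}" for x
      using v0[of x] that cd by simp
    moreover have "continuous_on {c..d} v"
      using cd by (intro continuous_on_subset[OF cv]) auto
    ultimately show "continuous_on {c..d} (\<lambda>x. v x powr (- \<gamma>))"
      by (intro continuous_on_powr continuous_on_const ballI)
  qed
  obtain zv where
    dv: "\<And>x. a < x \<Longrightarrow> x < b \<Longrightarrow> (v has_real_derivative spow ?r (zv x)) (at x)" and
    zv: "\<And>x y. a < x \<Longrightarrow> x \<le> y \<Longrightarrow> y < b \<Longrightarrow>
          ((\<lambda>x. ?g x * v x powr (- \<gamma>)) has_integral (zv x - zv y)) {x..y}"
  proof (rule dirichlet_solution_flux[OF \<open>1 < p\<close> v])
    show "(\<lambda>x. ?g x * v x powr (- \<gamma>)) absolutely_integrable_on {c..d}" if "a < c" "d < b" for c d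
      using that by (rule gi)
  qed (rule that)
  obtain w zw G where w: "continuous_on {a..b} w" "w a = 0" "w b = 0" "\<And>x. a < x \<Longrightarrow> x < b \<Longrightarrow> 0 < w x"
    "\<And>x. a < x \<Longrightarrow> x < b \<Longrightarrow> (w has_real_derivative spow ?r (zw x)) (at x)"
    "\<And>x y. a < x \<Longrightarrow> x \<le> y \<Longrightarrow> y < b \<Longrightarrow> (G has_integral (zw x - zw y)) {x..y}"
    "\<And>x. a < x \<Longrightarrow> x < b \<Longrightarrow> C\<^sub>f * max (m x) 0 * w x powr (- \<gamma>) \<le> G x"
    by (rule singular_supersolution[OF \<open>a < b\<close> r \<open>0 < \<gamma>\<close> \<open>0 < C\<^sub>f\<close> m]) (rule that)
  interpret ordered_sub_super a b ?r \<gamma> C\<^sub>f m f v zv "\<lambda>x. ?g x * v x powr (- \<gamma>)" w zw G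
  proof
    \<comment> \<open>The lower bound on \<open>f\<close> is used with the positive part of
      \<open>m\<close> and the upper bound with the negative part, which enters with a minus
      sign.\<close>
    show "?g x * v x powr (- \<gamma>) \<le> m x * f (v x)" if "a < x" "x < b" for x
    proof -
      have fv: "c\<^sub>f * v x powr (- \<gamma>) \<le> f (v x)" "f (v x) \<le> C\<^sub>f * v x powr (- \<gamma>)"
        using assms(9)[OF v0[OF that]] by auto
      have "?g x * v x powr (- \<gamma>)
          = max (m x) 0 * (c\<^sub>f * v x powr (- \<gamma>)) - max (- m x) 0 * (C\<^sub>f * v x powr (- \<gamma>))"
        by (simp add: algebra_simps)
      also have "\<dots> \<le> max (m x) 0 * f (v x) - max (- m x) 0 * f (v x)"
        using fv by (intro diff_mono mult_left_mono) auto
      also have "\<dots> = m x * f (v x)"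
        by (simp add: left_diff_distrib[symmetric] max_def)
      finally show ?thesis .
    qed
  qed (use assms m r cv v0 vab dv zv w in auto)
  obtain u z where u: "continuous_on {a..b} u" "u a = 0" "u b = 0" "\<And>x. a < x \<Longrightarrow> x < b \<Longrightarrow> 0 < u x"
    and du: "\<And>x. a < x \<Longrightarrow> x < b \<Longrightarrow> (u has_real_derivative spow ?r (z x)) (at x)"
    and z: "\<And>x y. a < x \<Longrightarrow> x \<le> y \<Longrightarrow> y < b \<Longrightarrow> ((\<lambda>s. m s * f (u s)) has_integral (z x - z y)) {x..y}"
    by (rule solution_between) (rule that)
  have "dirichlet_solution p a b (\<lambda>x s. m x * f s) u"
  proof (rule dirichlet_solutionI[where F = "\<lambda>x s. m x * f s", OF \<open>a < b\<close> \<open>1 < p\<close> u _ du z])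
    show "(\<lambda>x. m x * f (u x)) absolutely_integrable_on {c..d}" if cd: "a < c" "d < b" for c d
    proof (rule absolutely_integrable_mult_continuous)
      show "m absolutely_integrable_on {c..d}"
        using cd by (intro absolutely_integrable_on_subinterval[OF m]) auto
      have "continuous_on {c..d} u"
        using cd by (intro continuous_on_subset[OF u(1)]) auto
      then show "continuous_on {c..d} (\<lambda>x. f (u x))"
        using u(4) cd by (intro continuous_on_compose2[OF \<open>continuous_on {0<..} f\<close>]) auto
    qed
  qed
  then show ?thesis by blast
qed

end
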